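(* Let $n\ge 2$. The involutory monoid $(U^{\pm}T_n(F),{}^S)$ is nonfinitely based if $F$ is a field of characteristic $0$, and inherently nonfinitely based if $F$ is a field of odd characteristic and $n\ge 4$.
   Context: An $n\times n$ matrix $(\alpha_{ij})$ is triangular if $\alpha_{ij}=0$ whenever $j<i$. For a field $F$ of characteristic different from $2$, $U^{\pm}T_n(F)$ is the monoid, under matrix multiplication, of all triangular $n\times n$ matrices over $F$ whose diagonal entries all lie in $\{0,1,-1\}$. The skew transpose of $A=(\alpha_{ij})_{n\times n}$ is $A^S:=(\alpha_{n+1-j,\,n+1-i})_{n\times n}$ (reflection in the secondary diagonal). An involutory semigroup $(S,{}^* )$ is a semigroup with a unary operation satisfying $(ab)^*=b^*a^*$ and $(a^* )^*=a$. Involutory monoids are considered as involutory semigroups (signature: multiplication and the unary operation only). An involutory identity is a pair $\mathbf{u}\approx\mathbf{v}$ of elements of the free involutory semigroup $\mathcal{I}(\mathcal{X})$ on a countably infinite set $\mathcal{X}$, namely the free semigroup on $\mathcal{X}\cup\{x^*\mid x\in\mathcal{X}\}$ with $(y_1\cdots y_m)^*=y_m^*\cdots y_1^*$ and $(x^* )^*=x$; it holds in $(S,{}^* )$ if $\varphi(\mathbf{u})=\varphi(\mathbf{v})$ for every morphism of involutory semigroups $\varphi:\mathcal{I}(\mathcal{X})\to(S,{}^* )$. A variety of involutory semigroups is the class of all involutory semigroups satisfying a given set of involutory identities; it is finitely based if it can be defined by a finite set of them, and nonfinitely based otherwise. The variety generated by $(S,{}^* )$ consists of all involutory semigroups satisfying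 all identities of $(S,{}^* )$; $(S,{}^* )$ is (non)finitely based if this variety is. A variety is locally finite if all its finitely generated members are finite. A locally finite variety is inherently nonfinitely based if it is not contained in any finitely based, locally finite variety (of involutory semigroups); $(S,{}^* )$ is inherently nonfinitely based if the variety it generates is. *)

theory Defs
  imports "Jordan_Normal_Form.Matrix"
begin

section \<open>Involutory semigroups\<close>

record 'a invsg = "'a partial_object" +
  mul :: "'a \<Rightarrow> 'a \<Rightarrow> 'a"
  invol :: "'a \<Rightarrow> 'a"

locale involutory_semigroup =
  fixes S :: "'a invsg"
  assumes carrier_nonempty: "carrier S \<noteq> {}"
    and mul_closed: "\<lbrakk>a \<in> carrier S; b \<in> carrier S\<rbrakk> \<Longrightarrow> mul S a b \<in> carrier S"
    and mul_assoc: "\<lbrakk>a \<in> carrier S; b \<in> carrier S; c \<in> carrier S\<rbrakk>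
      \<Longrightarrow> mul S (mul S a b) c = mul S a (mul S b c)"
    and invol_closed: "a \<in> carrier S \<Longrightarrow> invol S a \<in> carrier S"
    and invol_mul: "\<lbrakk>a \<in> carrier S; b \<in> carrier S\<rbrakk>
      \<Longrightarrow> invol S (mul S a b) = mul S (invol S b) (invol S a)"
    and invol_invol: "a \<in> carrier S \<Longrightarrow> invol S (invol S a) = a"

definition invsg_hom :: "'a invsg \<Rightarrow> 'b invsg \<Rightarrow> ('a \<Rightarrow> 'b) set" where
  "invsg_hom S T =
    {\<phi>. (\<forall>a\<in>carrier S. \<phi> a \<in> carrier T)
       \<and> (\<forall>a\<in>carrier S. \<forall>b\<in>carrier S. \<phi> (mul S a b) = mul T (\<phi> a) (\<phi> b))
       \<and> (\<forall>a\<in>carrier S. \<phi> (invol S a) = invol T (\<phi> a))}"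

inductive_set invsg_generate :: "'a invsg \<Rightarrow> 'a set \<Rightarrow> 'a set"
  for S :: "'a invsg" and G :: "'a set" where
  gen: "a \<in> G \<Longrightarrow> a \<in> invsg_generate S G"
| gen_mul: "\<lbrakk>a \<in> invsg_generate S G; b \<in> invsg_generate S G\<rbrakk>
    \<Longrightarrow> mul S a b \<in> invsg_generate S G"
| gen_invol: "a \<in> invsg_generate S G \<Longrightarrow> invol S a \<in> invsg_generate S G"

definition finitely_generated :: "'a invsg \<Rightarrow> bool" where
  "finitely_generated S \<longleftrightarrow>
    (\<exists>G. finite G \<and> G \<subseteq> carrier S \<and> invsg_generate S G = carrier S)"


section \<open>Involutory identities\<close>

text \<open>The variables are the natural numbers.\<close>

datatype letter = Var nat | VarStar nat

fun letter_star :: "letter \<Rightarrow> letter" where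
  "letter_star (Var x) = VarStar x"
| "letter_star (VarStar x) = Var x"

definition free_invsg :: "letter list invsg" where
  "free_invsg =
    \<lparr>carrier = {w. w \<noteq> []}, mul = (@), invol = (\<lambda>w. rev (map letter_star w))\<rparr>"

lemma letter_star_letter_star [simp]: "letter_star (letter_star y) = y"
  by (cases y) simp_all

lemma involutory_semigroup_free_invsg: "involutory_semigroup free_invsg"
  by unfold_locales (auto simp: free_invsg_def rev_map comp_def)

definition identities :: "(letter list \<times> letter list) set" where
  "identities = carrier free_invsg \<times> carrier free_invsg"

definition holds_in :: "letter list \<times> letter list \<Rightarrow> 'a invsg \<Rightarrow> bool" where
  "holds_in e S \<longleftrightarrow> (\<forall>\<phi>\<in>invsg_hom free_invsg S. \<phi> (fst e) = \<phi> (snd e))"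

definition identities_of :: "'a invsg \<Rightarrow> (letter list \<times> letter list) set" where
  "identities_of S = {e \<in> identities. holds_in e S}"


section \<open>Varieties\<close>

text \<open>
  A class of structures over all types is not an object of HOL, so a variety is represented by its
  members whose carrier is a set of natural numbers; up to isomorphism these are all its countable
  members. Nothing is lost: an identity involves finitely many variables, so it fails in an
  involutory semigroup (over any type) iff it fails in a finitely generated, hence countable,
  subsemigroup closed under the involution. Therefore varieties are equal, or included in each
  other, iff their countable parts are. Finitely generated members are countable as well, so that
  local finiteness is also decided by the countable part.
\<close>

definition variety_defined_by :: "(letter list \<times> letter list) set \<Rightarrow> nat invsg set" where
  "variety_defined_by \<Sigma> = {S. involutory_semigroup S \<and> (\<forall>e\<in>\<Sigma>. holds_in e S)}"

definition is_variety :: "nat invsg set \<Rightarrow> bool" where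
  "is_variety V \<longleftrightarrow> (\<exists>\<Sigma>\<subseteq>identities. V = variety_defined_by \<Sigma>)"

definition finitely_based_variety :: "nat invsg set \<Rightarrow> bool" where
  "finitely_based_variety V \<longleftrightarrow>
    (\<exists>\<Sigma>\<subseteq>identities. finite \<Sigma> \<and> V = variety_defined_by \<Sigma>)"

definition locally_finite_variety :: "nat invsg set \<Rightarrow> bool" where
  "locally_finite_variety V \<longleftrightarrow> (\<forall>S\<in>V. finitely_generated S \<longrightarrow> finite (carrier S))"

definition inherently_nonfinitely_based_variety :: "nat invsg set \<Rightarrow> bool" where
  "inherently_nonfinitely_based_variety V \<longleftrightarrow>
    locally_finite_variety V \<and>
    \<not> (\<exists>W. is_variety W \<and> finitely_based_variety W \<and> locally_finite_variety W \<and> V \<subseteq> W)"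

definition variety_generated_by :: "'a invsg \<Rightarrow> nat invsg set" where
  "variety_generated_by S = variety_defined_by (identities_of S)"

definition nonfinitely_based :: "'a invsg \<Rightarrow> bool" where
  "nonfinitely_based S \<longleftrightarrow> \<not> finitely_based_variety (variety_generated_by S)"

definition inherently_nonfinitely_based :: "'a invsg \<Rightarrow> bool" where
  "inherently_nonfinitely_based S \<longleftrightarrow>
    inherently_nonfinitely_based_variety (variety_generated_by S)"


section \<open>Triangular matrices with the skew transpose\<close>

text \<open>Matrix indices start at 0, so reflection in the secondary diagonal sends the entry at
  \<open>(n - 1 - j, n - 1 - i)\<close> to \<open>(i, j)\<close>.\<close>

definition skew_transpose :: "nat \<Rightarrow> 'a mat \<Rightarrow> 'a mat" where
  "skew_transpose n A = mat n n (\<lambda>(i, j). A $$ (n - 1 - j, n - 1 - i))"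

definition UpmT :: "nat \<Rightarrow> 'a::field mat invsg" where
  "UpmT n =
    \<lparr>carrier = {A \<in> carrier_mat n n. upper_triangular A \<and> (\<forall>i<n. A $$ (i, i) \<in> {0, 1, -1})},
     mul = (*), invol = skew_transpose n\<rparr>"

lemma upper_triangular_mult_entry:
  fixes A B :: "'a::field mat"
  assumes "A \<in> carrier_mat n n" "B \<in> carrier_mat n n" "upper_triangular A" "upper_triangular B"
    and "j \<le> i" "i < n"
  shows "(A * B) $$ (i, j) = (if i = j then A $$ (i, i) * B $$ (i, i) else 0)"
proof -
  have "(A * B) $$ (i, j) = (\<Sum>k<n. A $$ (i, k) * B $$ (k, j))"
    using assms by (simp add: scalar_prod_def atLeast0LessThan)
  also have "\<dots> = (\<Sum>k<n. if k = i then (if i = j then A $$ (i, i) * B $$ (i, i) else 0) else 0)"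
  proof (rule sum.cong[OF refl])
    fix k assume "k \<in> {..<n}"
    then show "A $$ (i, k) * B $$ (k, j) =
        (if k = i then (if i = j then A $$ (i, i) * B $$ (i, i) else 0) else 0)"
      using assms upper_triangularD[of A k i] upper_triangularD[of B j k]
      by (cases k i rule: linorder_cases) auto
  qed
  finally show ?thesis
    using assms by simp
qed

lemma involutory_semigroup_UpmT: "involutory_semigroup (UpmT n :: 'a::field mat invsg)"
proof unfold_locales
  show "carrier (UpmT n :: 'a mat invsg) \<noteq> {}"
    by (auto simp: UpmT_def intro!: exI[of _ "1\<^sub>m n"])
next
  fix A B :: "'a mat" assume AB: "A \<in> carrier (UpmT n)" "B \<in> carrier (UpmT n)"
  then have *: "A \<in> carrier_mat n n" "B \<in> carrier_mat n n" "upper_triangular A" "upper_triangular B"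
    and d: "\<And>i. i < n \<Longrightarrow> A $$ (i, i) \<in> {0, 1, -1}" "\<And>i. i < n \<Longrightarrow> B $$ (i, i) \<in> {0, 1, -1}"
    by (auto simp: UpmT_def)
  have "A * B \<in> carrier_mat n n"
    using * by simp
  moreover have "upper_triangular (A * B)"
  proof
    fix i j assume "j < i" "i < dim_row (A * B)"
    then show "(A * B) $$ (i, j) = 0"
      using upper_triangular_mult_entry[OF *, of j i] * by simp
  qed
  moreover have "(A * B) $$ (i, i) \<in> {0, 1, -1}" if "i < n" for i
    using upper_triangular_mult_entry[OF *, of i i] that d(1)[OF that] d(2)[OF that] by auto
  ultimately show "mul (UpmT n) A B \<in> carrier (UpmT n)"
    by (simp add: UpmT_def)
  show "invol (UpmT n) (mul (UpmT n) A B)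
      = mul (UpmT n) (invol (UpmT n) B) (invol (UpmT n) A)"
  proof (rule eq_matI)
    fix i j
    assume "i < dim_row (mul (UpmT n) (invol (UpmT n) B) (invol (UpmT n) A))"
      and "j < dim_col (mul (UpmT n) (invol (UpmT n) B) (invol (UpmT n) A))"
    then have ij: "i < n" "j < n"
      by (auto simp: UpmT_def skew_transpose_def)
    have "(\<Sum>k<n. A $$ (n - 1 - j, k) * B $$ (k, n - 1 - i))
        = (\<Sum>k<n. A $$ (n - 1 - j, n - 1 - k) * B $$ (n - 1 - k, n - 1 - i))"
      by (rule sum.reindex_bij_witness[of _ "\<lambda>k. n - 1 - k" "\<lambda>k. n - 1 - k"]) auto
    then show "invol (UpmT n) (mul (UpmT n) A B) $$ (i, j)
        = mul (UpmT n) (invol (UpmT n) B) (invol (UpmT n) A) $$ (i, j)"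
      using ij * by (simp add: UpmT_def skew_transpose_def scalar_prod_def atLeast0LessThan
          mult.commute)
  qed (simp_all add: UpmT_def skew_transpose_def)
next
  fix A B C :: "'a mat"
  assume "A \<in> carrier (UpmT n)" "B \<in> carrier (UpmT n)" "C \<in> carrier (UpmT n)"
  then show "mul (UpmT n) (mul (UpmT n) A B) C = mul (UpmT n) A (mul (UpmT n) B C)"
    by (auto simp: UpmT_def intro: assoc_mult_mat)
next
  fix A :: "'a mat" assume A: "A \<in> carrier (UpmT n)"
  then show "invol (UpmT n) A \<in> carrier (UpmT n)"
    by (auto simp: UpmT_def skew_transpose_def intro!: upper_triangularI upper_triangularD[of A])
  show "invol (UpmT n) (invol (UpmT n) A) = A"
    using A by (auto simp: UpmT_def skew_transpose_def intro!: eq_matI)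
qed

end

theory Submission
  imports Defs "HOL-Library.Countable_Set"
begin

text \<open>
  For every \<open>k\<close> there is a set \<open>L\<close> of words, closed under factors, such that a word \<open>u\<close> in at most
  \<open>k\<close> variables which takes a value in \<open>L\<close> is an isoterm: the triangular matrices satisfy no identity
  \<open>u \<approx> v\<close> with \<open>v \<noteq> u\<close>. Hence the semigroup \<open>L \<union> L* \<union> {0}\<close>, in which products outside \<open>L\<close> are 0,
  satisfies all identities of the matrices in at most \<open>k\<close> variables.

  In odd characteristic \<open>L\<close> consists of the factors of the iterates of the substitution
  \<open>(p, q) \<mapsto> (p, 0)(q, 1)(p, 2)(q, 3)\<dots>\<close>, so it is infinite over a finite alphabet, while the variety
  of the matrices is locally finite. A word in few variables that hits \<open>L\<close> reduces to the empty word by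
  deletions of free sets of variables, as in the theory of unavoidable words. That such words are
  isoterms follows by undoing the deletions: matrices of size 4 with diagonal \<open>\<chi>, 0, 0, 1\<close> count the
  occurrences of a factor of length at most 3, weighted by a character \<open>\<chi>\<close> of the prefix, and Fourier
  inversion then counts the occurrences behind a prefix of given parity vector.

  In characteristic 0 matrices of size 2 suffice to see that a word is an isoterm if no factor contains
  every letter an even number of times. Take \<open>L\<close> to be the factors of a Malcev word \<open>q\<^sub>n\<close>,
  \<open>q\<^sub>m\<^sub>+\<^sub>1 = w q\<^sub>m z p\<^sub>m w'\<close>, \<open>p\<^sub>m\<^sub>+\<^sub>1 = w p\<^sub>m z q\<^sub>m w'\<close>, whose letters are replaced by long permutations of
  one alphabet. These permutations have equal diagonals in every matrix assignment, which makes
  \<open>q\<^sub>n \<approx> p\<^sub>n\<close> an identity of the \<open>n \<times> n\<close> matrices, and it fails in the semigroup of \<open>L\<close>.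
\<close>

subsection \<open>Words without even factors\<close>

definition no_even_factor :: "'a list \<Rightarrow> bool" where
  "no_even_factor u \<longleftrightarrow>
    (\<forall>a e b. u = a @ e @ b \<longrightarrow> (\<forall>x. even (count_list e x)) \<longrightarrow> e = [])"

lemma no_even_factorD:
  "no_even_factor u \<Longrightarrow> u = a @ e @ b \<Longrightarrow> (\<And>x. even (count_list e x)) \<Longrightarrow> e = []"
  unfolding no_even_factor_def by blast

lemma no_even_factor_Cons:
  assumes "no_even_factor u" "t \<notin> set u"
  shows "no_even_factor (t # u)"
  unfolding no_even_factor_def
proof (intro allI impI)
  fix a e b assume eq: "t # u = a @ e @ b" and ev: "\<forall>x. even (count_list e x)"
  show "e = []"
  proof (cases a)
    case Nil
    show ?thesis
    proof (rule ccontr)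
      assume "e \<noteq> []"
      then obtain e' where e: "e = t # e'" "u = e' @ b"
        using eq Nil by (cases e) auto
      then have "count_list e' t = 0"
        using assms(2) by (simp add: count_list_0_iff)
      then show False
        using ev e(1) by (metis count_list.simps(2) even_Suc even_zero Suc_eq_plus1)
    qed
  next
    case (Cons c a')
    then show ?thesis
      using eq ev no_even_factorD[OF assms(1), of a' e b] by auto
  qed
qed

lemma no_even_factor_rev:
  assumes "no_even_factor u"
  shows "no_even_factor (rev u)"
  unfolding no_even_factor_def
proof (intro allI impI)
  fix a e b assume eq: "rev u = a @ e @ b" and ev: "\<forall>x. even (count_list e x)"
  have "u = rev b @ rev e @ rev a"
    using arg_cong[OF eq, of rev] by simp
  then show "e = []"
    using no_even_factorD[OF assms, of "rev b" "rev e" "rev a"] ev by simp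
qed

lemma no_even_factor_snoc:
  assumes "no_even_factor u" "t \<notin> set u"
  shows "no_even_factor (u @ [t])"
  using no_even_factor_rev[OF no_even_factor_Cons[OF no_even_factor_rev[OF assms(1)], of t]] assms(2)
  by simp

text \<open>The stretch between the two cuts is even, hence empty. Positions in such a word are thus
  named by parity vectors, which is what characters with values \<open>1\<close> and
  \<open>-1\<close> can detect.\<close>

lemma no_even_factor_take:
  assumes "no_even_factor u" "i \<le> length u" "j \<le> length u"
    and "\<And>x. odd (count_list (take i u) x) = odd (count_list (take j u) x)"
  shows "i = j"
proof -
  have *: "i = j" if "i \<le> j" "j \<le> length u"
      "\<And>x. odd (count_list (take i u) x) = odd (count_list (take j u) x)" for i j
  proof -
    have tj: "take j u = take i u @ take (j - i) (drop i u)"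
      using that by (metis le_add_diff_inverse take_add)
    have "take (j - i) (drop i u) = []"
    proof (rule no_even_factorD[OF assms(1)])
      show "u = take i u @ take (j - i) (drop i u) @ drop j u"
        by (metis append_assoc append_take_drop_id tj)
      show "even (count_list (take (j - i) (drop i u)) x)" for x
        using that(3)[of x] tj by (metis count_list_append even_add)
    qed
    then show ?thesis
      using that by auto
  qed
  show ?thesis
    using *[of i j] *[of j i] assms(2-) by (cases "i \<le> j") auto
qed

lemma count_list_filter:
  "count_list (filter P u) x = (if P x then count_list u x else 0)"
  by (induction u) auto

lemma even_count_filter: "even (count_list u x) \<Longrightarrow> even (count_list (filter P u) x)"
  by (simp add: count_list_filter)

subsection \<open>Reducible words\<close>

text \<open>The labels tell whether the left and the right boundary of a variable lie before or after the
  deleted slot next to it; this is deletion of a free set in the sense of Bean, Ehrenfeucht and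
  McNulty.\<close>

inductive reducible :: "'a list \<Rightarrow> bool" where
  reducible_Nil: "reducible []"
| reducible_step: "reducible u"
  if "successively (\<lambda>x y. \<rho> x = \<kappa> y) u" "\<And>x. x \<in> D \<Longrightarrow> \<not> \<kappa> x \<and> \<rho> x"
    "reducible (filter (\<lambda>x. x \<notin> D) u)"

lemma reducible_short:
  assumes "length u \<le> 1"
  shows "reducible u"
  by (rule reducible_step[of "\<lambda>_. True" "\<lambda>_. False" _ UNIV])
    (use assms in \<open>cases u; cases "tl u"; auto intro: reducible_Nil\<close>)+

text \<open>What an even factor leaves after the deletion is even again, so by induction all its
  letters are deleted. Two deleted letters are never adjacent, because their labels disagree at the
  common boundary, and a single letter is not even.\<close>

lemma reducible_no_even_factor: "reducible u \<Longrightarrow> no_even_factor u"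
proof (induction rule: reducible.induct)
  case reducible_Nil
  then show ?case by (simp add: no_even_factor_def)
next
  case (reducible_step \<rho> l u D)
  show ?case
    unfolding no_even_factor_def
  proof (intro allI impI)
    fix a e b assume u: "u = a @ e @ b" and ev: "\<forall>x. even (count_list e x)"
    have "filter (\<lambda>x. x \<notin> D) e = []"
      by (rule no_even_factorD[OF reducible_step.IH, of "filter (\<lambda>x. x \<notin> D) a" _ "filter (\<lambda>x. x \<notin> D) b"])
        (use u ev in \<open>auto intro: even_count_filter\<close>)
    then have D: "set e \<subseteq> D"
      by (auto simp: filter_empty_conv)
    show "e = []"
    proof (cases e)
      case (Cons x e')
      show ?thesis
      proof (cases e')
        case Nil
        then show ?thesis using ev[rule_format, of x] Cons by simp
      next
        case (Cons y e'')
        then have "\<rho> x = l y"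
          using reducible_step.hyps(1) u \<open>e = x # e'\<close> by (auto simp: successively_append_iff)
        then show ?thesis
          using D reducible_step.hyps(2)[of x] reducible_step.hyps(2)[of y] Cons \<open>e = x # e'\<close> by auto
      qed
    qed simp
  qed
qed

text \<open>Short variables of a phase-consistent word are deleted in the order of their right phases.\<close>

lemma reducible_layers:
  fixes \<alpha> \<beta> :: "'a \<Rightarrow> nat"
  assumes con: "successively (\<lambda>x y. \<beta> x = \<alpha> y) u"
    and D: "\<And>x. x \<in> D \<Longrightarrow> \<alpha> x < \<beta> x"
    and red: "reducible (filter (\<lambda>x. x \<notin> D) u)"
  shows "reducible u"
proof -
  \<comment> \<open>\<open>P \<tau>\<close> keeps what is left once the letters of \<open>D\<close>
    with right phase below \<open>\<tau>\<close> are gone; the labels at this stage compare the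
    phases with \<open>\<tau>\<close>.\<close>
  define P where "P \<tau> x \<longleftrightarrow> \<not> (x \<in> D \<and> \<beta> x < \<tau>)" for \<tau> x
  \<comment> \<open>A deleted letter has both phases below \<open>\<tau>\<close>, so a run of
    deleted letters carries the same truth value across the gap.\<close>
  have hd_phase: "\<tau> \<le> \<beta> x \<longleftrightarrow> \<tau> \<le> \<alpha> y"
    if "successively (\<lambda>x y. \<beta> x = \<alpha> y) (x # w)" "filter (P \<tau>) w = y # ys" for \<tau> x y w ys
    using that
  proof (induction w arbitrary: x)
    case (Cons z w)
    show ?case
    proof (cases "P \<tau> z")
      case False
      then have "z \<in> D" "\<beta> z < \<tau>" by (auto simp: P_def)
      with Cons.prems Cons.IH[of z] False D[of z] show ?thesis by simp
    qed (use Cons.prems in auto)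
  qed simp
  have con': "successively (\<lambda>x y. (\<tau> \<le> \<beta> x) = (\<tau> \<le> \<alpha> y)) (filter (P \<tau>) w)"
    if "successively (\<lambda>x y. \<beta> x = \<alpha> y) w" for \<tau> w
    using that
  proof (induction w)
    case (Cons x w)
    then have IH: "successively (\<lambda>x y. (\<tau> \<le> \<beta> x) = (\<tau> \<le> \<alpha> y)) (filter (P \<tau>) w)"
      by (cases w) auto
    show ?case
      using IH hd_phase[OF Cons.prems] by (cases "filter (P \<tau>) w") auto
  qed simp
  have step: "reducible (filter (P \<tau>) u)" if "reducible (filter (P (Suc \<tau>)) u)" for \<tau>
  proof (rule reducible_step[OF con'[OF con]])
    show "\<not> \<tau> \<le> \<alpha> x \<and> \<tau> \<le> \<beta> x" if "x \<in> {x \<in> D. \<beta> x = \<tau>}" for x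
      using that D[of x] by auto
    have "filter (\<lambda>x. x \<notin> {x \<in> D. \<beta> x = \<tau>}) (filter (P \<tau>) u) = filter (P (Suc \<tau>)) u"
      by (auto simp: P_def intro!: filter_cong)
    with that show "reducible (filter (\<lambda>x. x \<notin> {x \<in> D. \<beta> x = \<tau>}) (filter (P \<tau>) u))"
      by simp
  qed
  \<comment> \<open>Beyond all right phases every letter of \<open>D\<close> is gone; from there the
    layers are put back one by one down to phase \<open>0\<close>, where nothing is deleted.\<close>
  define N where "N = Suc (Max (\<beta> ` set u))"
  have "\<beta> x < N" if "x \<in> set u" for x
    using that by (simp add: N_def le_imp_less_Suc)
  then have "filter (P N) u = filter (\<lambda>x. x \<notin> D) u"
    by (auto simp: P_def intro!: filter_cong)
  then have "reducible (filter (P N) u)"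
    using red by simp
  then have "reducible (filter (P (N - i)) u)" for i
  proof (induction i)
    case (Suc i)
    then show ?case
      using step[of "N - Suc i"] by (cases "i < N") (auto simp: Suc_diff_Suc)
  qed simp
  from this[of N] show ?thesis
    by (simp add: P_def)
qed

subsection \<open>Rows\<close>

text \<open>Any two adjacent letters of a row determine the row, although the single letters come from an
  alphabet that does not grow when the substitution is iterated.\<close>

definition alt_row :: "nat \<Rightarrow> nat \<times> nat \<Rightarrow> (nat \<times> nat) list" where
  "alt_row r = (\<lambda>(p, q). map (\<lambda>t. (if even t then p else q, t)) [0..<r])"

definition alt_rows :: "nat \<Rightarrow> (nat \<times> nat) list \<Rightarrow> (nat \<times> nat) list" where
  "alt_rows r g = concat (map (alt_row r) g)"

text \<open>Decodes rows from the adjacent columns \<open>t\<close> and \<open>t + 1\<close>; for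
  odd \<open>t\<close> the two entries of a row come in reverse order.\<close>

fun read_rows :: "nat \<Rightarrow> (nat \<times> nat) list \<Rightarrow> (nat \<times> nat) list" where
  "read_rows t (a # b # w) =
    (if snd a = t then [if even t then (fst a, fst b) else (fst b, fst a)] else [])
    @ read_rows t (b # w)"
| "read_rows t _ = []"

lemma read_rows_append:
  assumes "x = [] \<or> y = [] \<or> snd (last x) \<noteq> t"
  shows "read_rows t (x @ y) = read_rows t x @ read_rows t y"
  using assms
proof (induction t x rule: read_rows.induct)
  case ("2_1" t)
  then show ?case by simp
next
  case ("2_2" t a)
  then show ?case by (cases y) auto
qed auto

text \<open>At an arbitrary cut a pair may be separated; \<open>c\<close> holds the row read from
  the pair across the cut, if there is one.\<close>

lemma read_rows_append_ex: "\<exists>c. read_rows t (x @ y) = read_rows t x @ c @ read_rows t y"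
proof (induction t x rule: read_rows.induct)
  case ("2_1" t)
  then show ?case by auto
next
  case ("2_2" t a)
  then show ?case by (cases y) auto
qed auto

lemma read_rows_none: "(\<And>a. a \<in> set w \<Longrightarrow> snd a \<noteq> t) \<Longrightarrow> read_rows t w = []"
  by (induction t w rule: read_rows.induct) auto

lemma read_rows_alt_row:
  assumes "Suc t < r"
  shows "read_rows t (alt_row r z) = [z]"
proof -
  obtain p q where z: "z = (p, q)" by fastforce
  define f where "f t = (if even t then p else q, t)" for t :: nat
  have "[0..<r] = [0..<t] @ [t..<r]"
    using upt_add_eq_append[of 0 t "r - t"] assms by simp
  also have "[t..<r] = t # Suc t # [Suc (Suc t)..<r]"
    using assms by (simp add: upt_conv_Cons)
  finally have eq: "alt_row r z = map f [0..<t] @ f t # f (Suc t) # map f [Suc (Suc t)..<r]"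
    unfolding alt_row_def z f_def by simp
  have "read_rows t (alt_row r z) =
      read_rows t (map f [0..<t]) @ read_rows t (f t # f (Suc t) # map f [Suc (Suc t)..<r])"
    unfolding eq by (rule read_rows_append) (auto simp: f_def last_map)
  also have "read_rows t (map f [0..<t]) = []"
    by (rule read_rows_none) (auto simp: f_def)
  also have "read_rows t (f t # f (Suc t) # map f [Suc (Suc t)..<r]) =
      z # read_rows t (f (Suc t) # map f [Suc (Suc t)..<r])"
    by (auto simp: f_def z)
  also have "read_rows t (f (Suc t) # map f [Suc (Suc t)..<r]) = []"
    by (rule read_rows_none) (auto simp: f_def)
  finally show ?thesis by simp
qed

lemma snd_last_alt_row: "0 < r \<Longrightarrow> snd (last (alt_row r z)) = r - 1"
  by (cases z) (simp add: alt_row_def last_map)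

lemma alt_row_nonempty: "0 < r \<Longrightarrow> alt_row r z \<noteq> []"
  by (cases z) (simp add: alt_row_def)

text \<open>A row ends in column \<open>r - 1\<close>, which differs from \<open>t\<close>, so
  nothing is read across two rows.\<close>

lemma read_rows_alt_rows:
  assumes "Suc t < r"
  shows "read_rows t (alt_rows r g) = g"
proof (induction g)
  case (Cons z g)
  have "read_rows t (alt_rows r (z # g)) = read_rows t (alt_row r z) @ read_rows t (alt_rows r g)"
    using assms unfolding alt_rows_def by (simp add: read_rows_append[OF disjI2[OF disjI2]] snd_last_alt_row)
  with Cons assms show ?case
    by (simp add: read_rows_alt_row)
qed (simp add: alt_rows_def)

abbreviation column_step :: "nat \<Rightarrow> nat \<times> nat \<Rightarrow> nat \<times> nat \<Rightarrow> bool" where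
  "column_step r a b \<equiv> snd b = Suc (snd a) mod r"

lemma snd_alt_rows_less: "a \<in> set (alt_rows r g) \<Longrightarrow> snd a < r"
  by (auto simp: alt_rows_def alt_row_def)

lemma successively_alt_rows:
  assumes "0 < r"
  shows "successively (column_step r) (alt_rows r g)"
proof (induction g)
  case (Cons z g)
  have "successively (column_step r) (alt_row r z)"
    unfolding alt_row_def successively_conv_nth by (cases z) auto
  moreover have "column_step r (last (alt_row r z)) (hd (alt_rows r g))" if ne: "alt_rows r g \<noteq> []"
  proof -
    obtain z' g' where g: "g = z' # g'"
      using ne by (cases g) (auto simp: alt_rows_def)
    have "snd (hd (alt_rows r g)) = 0"
      unfolding g alt_rows_def using assms alt_row_nonempty[OF assms, of z']
      by (cases z') (simp add: alt_row_def hd_map hd_append)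
    then show ?thesis
      using assms by (simp add: snd_last_alt_row)
  qed
  ultimately show ?case
    using Cons by (auto simp: alt_rows_def successively_append_iff)
qed (simp add: alt_rows_def)

text \<open>The distance of column \<open>c\<close> from column \<open>t + 1\<close>, going right cyclically.\<close>

definition offset :: "nat \<Rightarrow> nat \<Rightarrow> nat \<Rightarrow> nat" where
  "offset r t c = (if t < c then c - Suc t else c + r - Suc t)"

text \<open>The step out of column \<open>t\<close> is excluded, since there the offset falls from
  \<open>r - 1\<close> to \<open>0\<close>.\<close>

lemma offset_Suc:
  "\<lbrakk>c < r; c \<noteq> t; Suc t < r\<rbrakk> \<Longrightarrow> offset r t (Suc c mod r) = Suc (offset r t c)"
  by (cases "Suc c = r") (auto simp: offset_def)

text \<open>Reading nothing means that no letter but possibly the last lies in column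
  \<open>t\<close>, so each step raises the offset by one.\<close>

lemma offset_mono:
  assumes "successively (column_step r) w" "w \<noteq> []" "\<And>a. a \<in> set w \<Longrightarrow> snd a < r"
    and "read_rows t w = []" "Suc t < r"
  shows "offset r t (snd (hd w)) \<le> offset r t (snd (last w))"
  using assms
proof (induction t w rule: read_rows.induct)
  case (1 t a b w)
  then show ?case
    using offset_Suc[of "snd a" r t] by (auto split: if_splits)
qed auto

text \<open>By pigeonhole there is a column \<open>t + 1\<close> in which no value of a variable
  starts, so decoding at \<open>t\<close> respects the boundaries between variables. The phases are
  offsets of these boundaries; a variable that decodes to nothing does not pass from
  \<open>t\<close> to \<open>t + 1\<close>, so its right phase is larger.\<close>

lemma desubstitution:
  fixes \<phi> :: "'v \<Rightarrow> (nat \<times> nat) list"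
  assumes eq: "pre @ concat (map \<phi> u) @ suf = alt_rows r g"
    and ne: "\<forall>x\<in>set u. \<phi> x \<noteq> []"
    and r: "Suc (card (set u)) < r"
  shows "\<exists>(\<phi>' :: 'v \<Rightarrow> (nat \<times> nat) list) (\<alpha> :: 'v \<Rightarrow> nat) (\<beta> :: 'v \<Rightarrow> nat) pre' suf'.
    pre' @ concat (map \<phi>' u) @ suf' = g \<and> successively (\<lambda>x y. \<beta> x = \<alpha> y) u \<and>
    (\<forall>x\<in>set u. \<phi>' x = [] \<longrightarrow> \<alpha> x < \<beta> x)"
proof -
  define \<kappa> where "\<kappa> x = snd (hd (\<phi> x))" for x
  have "card (\<kappa> ` set u) < card {1..<r}"
    using card_image_le[of "set u" \<kappa>] r by simp
  then have "\<not> {1..<r} \<subseteq> \<kappa> ` set u"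
    by (meson List.finite_set card_mono finite_imageI not_less)
  then obtain c where c: "1 \<le> c" "c < r" "c \<notin> \<kappa> ` set u"
    by (metis atLeastLessThan_iff subsetI)
  then obtain t where t: "Suc t < r" "Suc t \<notin> \<kappa> ` set u"
    by (cases c) auto
  have "successively (column_step r) (pre @ concat (map \<phi> u) @ suf)"
    unfolding eq using t by (intro successively_alt_rows) simp
  then have suc: "successively (column_step r) (concat (map \<phi> u))"
    by (simp add: successively_append_iff)
  have less: "snd a < r" if "a \<in> set (concat (map \<phi> u))" for a
    using that snd_alt_rows_less[of a r g] unfolding eq[symmetric] by simp
  have cons: "successively (\<lambda>x y. \<kappa> y = Suc (snd (last (\<phi> x))) mod r) w"
    if "successively (column_step r) (concat (map \<phi> w))" "set w \<subseteq> set u" for w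
    using that
  proof (induction w)
    case (Cons x w)
    then show ?case
      using ne by (cases w) (auto simp: successively_append_iff \<kappa>_def)
  qed simp
  have cut: "successively (\<lambda>x y. snd (last (\<phi> x)) \<noteq> t \<and> \<kappa> y = Suc (snd (last (\<phi> x))) mod r) u"
    using cons[OF suc order_refl]
  proof (rule successively_mono)
    fix x y assume "x \<in> set u" "y \<in> set u" "\<kappa> y = Suc (snd (last (\<phi> x))) mod r"
    then show "snd (last (\<phi> x)) \<noteq> t \<and> \<kappa> y = Suc (snd (last (\<phi> x))) mod r"
      using t by (metis imageI mod_less)
  qed
  have read: "read_rows t (concat (map \<phi> w)) = concat (map (\<lambda>x. read_rows t (\<phi> x)) w)"
    if "successively (\<lambda>x y. snd (last (\<phi> x)) \<noteq> t \<and> \<kappa> y = Suc (snd (last (\<phi> x))) mod r) w" for w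
    using that
  proof (induction w)
    case (Cons x w)
    show ?case
    proof (cases w)
      case (Cons y w')
      then show ?thesis
        using Cons.IH Cons.prems read_rows_append[of "\<phi> x" "concat (map \<phi> w)" t] by auto
    qed simp
  qed simp
  have phi: "\<phi> x \<noteq> []" "successively (column_step r) (\<phi> x)" "\<And>a. a \<in> set (\<phi> x) \<Longrightarrow> snd a < r"
    if x: "x \<in> set u" for x
  proof -
    show "\<phi> x \<noteq> []" using ne x by blast
    show "\<And>a. a \<in> set (\<phi> x) \<Longrightarrow> snd a < r"
      using x less by auto
    obtain u1 u2 where "u = u1 @ x # u2"
      using x by (meson split_list)
    then show "successively (column_step r) (\<phi> x)"
      using suc by (auto simp: successively_append_iff)
  qed
  obtain c1 where c1: "g = read_rows t pre @ c1 @ read_rows t (concat (map \<phi> u) @ suf)"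
    using read_rows_append_ex[of t pre] read_rows_alt_rows[OF t(1), of g] unfolding eq[symmetric] by metis
  obtain c2 where c2: "read_rows t (concat (map \<phi> u) @ suf) =
      read_rows t (concat (map \<phi> u)) @ c2 @ read_rows t suf"
    using read_rows_append_ex by metis
  show ?thesis
  proof (intro exI conjI ballI impI)
    show "(read_rows t pre @ c1) @ concat (map (\<lambda>x. read_rows t (\<phi> x)) u) @ (c2 @ read_rows t suf) = g"
      using c1 c2 read[OF cut] by simp
    \<comment> \<open>The right phase is one past the offset of the last letter. By the choice of
      \<open>t\<close> this letter is not in column \<open>t\<close> if another variable follows, so
      the right phase meets the next left phase without wrapping round.\<close>
    show "successively (\<lambda>x y. Suc (offset r t (snd (last (\<phi> x)))) = offset r t (\<kappa> y)) u"
      using cut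
    proof (rule successively_mono)
      fix x y assume xy: "x \<in> set u" "y \<in> set u"
        "snd (last (\<phi> x)) \<noteq> t \<and> \<kappa> y = Suc (snd (last (\<phi> x))) mod r"
      then show "Suc (offset r t (snd (last (\<phi> x)))) = offset r t (\<kappa> y)"
        using offset_Suc[of "snd (last (\<phi> x))" r t] phi(1,3)[of x] t(1) by simp
    qed
    show "offset r t (\<kappa> x) < Suc (offset r t (snd (last (\<phi> x))))"
      if "x \<in> set u" "read_rows t (\<phi> x) = []" for x
      using offset_mono[OF phi(2,1,3) _ t(1)] that unfolding \<kappa>_def by (simp add: less_Suc_eq_le)
  qed
qed

subsection \<open>Evaluation of words\<close>

fun letter_val :: "'a invsg \<Rightarrow> (nat \<Rightarrow> 'a) \<Rightarrow> letter \<Rightarrow> 'a" where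
  "letter_val S a (Var x) = a x"
| "letter_val S a (VarStar x) = invol S (a x)"

text \<open>The empty word has no value in a semigroup, so the recursion stops at a single letter
  and the first clause is a dummy.\<close>

fun word_val :: "'a invsg \<Rightarrow> (nat \<Rightarrow> 'a) \<Rightarrow> letter list \<Rightarrow> 'a" where
  "word_val S a [] = undefined"
| "word_val S a [l] = letter_val S a l"
| "word_val S a (l # l' # w) = mul S (letter_val S a l) (word_val S a (l' # w))"

lemma word_val_Cons: "w \<noteq> [] \<Longrightarrow> word_val S a (l # w) = mul S (letter_val S a l) (word_val S a w)"
  by (cases w) auto

context involutory_semigroup
begin

lemma letter_val_closed: "(\<And>x. a x \<in> carrier S) \<Longrightarrow> letter_val S a l \<in> carrier S"
  by (cases l) (auto intro: invol_closed)

lemma word_val_closed: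
  assumes "\<And>x. a x \<in> carrier S" "w \<noteq> []"
  shows "word_val S a w \<in> carrier S"
  using assms(2)
  by (induction w rule: list_nonempty_induct)
    (auto simp: word_val_Cons intro: mul_closed letter_val_closed assms(1))

lemma word_val_append:
  assumes "\<And>x. a x \<in> carrier S" "v \<noteq> []" "w \<noteq> []"
  shows "word_val S a (v @ w) = mul S (word_val S a v) (word_val S a w)"
  using assms(2)
proof (induction v rule: list_nonempty_induct)
  case (single l)
  then show ?case using assms(3) by (simp add: word_val_Cons)
next
  case (cons l v)
  then show ?case
    using assms by (simp add: word_val_Cons mul_assoc letter_val_closed word_val_closed)
qed

lemma letter_val_star:
  "(\<And>x. a x \<in> carrier S) \<Longrightarrow> letter_val S a (letter_star l) = invol S (letter_val S a l)"
  by (cases l) (auto simp: invol_invol)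

lemma word_val_star:
  assumes "\<And>x. a x \<in> carrier S" "w \<noteq> []"
  shows "word_val S a (rev (map letter_star w)) = invol S (word_val S a w)"
  using assms(2)
proof (induction w rule: list_nonempty_induct)
  case (single l)
  then show ?case using assms(1) by (simp add: letter_val_star)
next
  case (cons l w)
  then show ?case
    using assms
    by (simp add: word_val_Cons word_val_append letter_val_star invol_mul letter_val_closed
        word_val_closed)
qed

lemma word_val_hom:
  "(\<And>x. a x \<in> carrier S) \<Longrightarrow> word_val S a \<in> invsg_hom free_invsg S"
  by (auto simp: invsg_hom_def free_invsg_def word_val_closed word_val_append word_val_star)

lemma hom_word_val:
  assumes "\<phi> \<in> invsg_hom free_invsg S" "w \<noteq> []"
  shows "\<phi> w = word_val S (\<lambda>x. \<phi> [Var x]) w"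
proof -
  have mul: "\<phi> (v @ w) = mul S (\<phi> v) (\<phi> w)" if "v \<noteq> []" "w \<noteq> []" for v w
    using assms(1) that by (auto simp: invsg_hom_def free_invsg_def)
  have inv: "\<phi> [VarStar x] = invol S (\<phi> [Var x])" for x
  proof -
    have "\<phi> (invol free_invsg [Var x]) = invol S (\<phi> [Var x])"
      using assms(1) unfolding invsg_hom_def
      by (elim CollectE conjE bspec) (simp add: free_invsg_def)
    then show ?thesis by (simp add: free_invsg_def)
  qed
  have letter: "\<phi> [l] = letter_val S (\<lambda>x. \<phi> [Var x]) l" for l
    by (cases l) (auto simp: inv)
  show ?thesis
    using assms(2)
  proof (induction w rule: list_nonempty_induct)
    case (single l)
    show ?case using letter[of l] by simp
  next
    case (cons l w)
    have "\<phi> (l # w) = mul S (\<phi> [l]) (\<phi> w)"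
      using mul[of "[l]" w] cons.hyps by simp
    then show ?case
      unfolding word_val_Cons[OF cons.hyps] using letter[of l] cons.IH by metis
  qed
qed

lemma hom_Var_closed: "\<phi> \<in> invsg_hom free_invsg S \<Longrightarrow> \<phi> [Var x] \<in> carrier S"
  by (auto simp: invsg_hom_def free_invsg_def)

lemma holds_in_iff:
  assumes "u \<noteq> []" "v \<noteq> []"
  shows "holds_in (u, v) S \<longleftrightarrow>
    (\<forall>a. (\<forall>x. a x \<in> carrier S) \<longrightarrow> word_val S a u = word_val S a v)"
proof
  assume L: "holds_in (u, v) S"
  show "\<forall>a. (\<forall>x. a x \<in> carrier S) \<longrightarrow> word_val S a u = word_val S a v"
    using L word_val_hom by (auto simp: holds_in_def)
next
  assume R: "\<forall>a. (\<forall>x. a x \<in> carrier S) \<longrightarrow> word_val S a u = word_val S a v"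
  show "holds_in (u, v) S"
    unfolding holds_in_def
  proof
    fix \<phi> assume phi: "\<phi> \<in> invsg_hom free_invsg S"
    show "\<phi> (fst (u, v)) = \<phi> (snd (u, v))"
      using hom_word_val[OF phi assms(1)] hom_word_val[OF phi assms(2)] R hom_Var_closed[OF phi]
      by simp
  qed
qed

end

subsection \<open>Countable involutory semigroups as members of varieties\<close>

text \<open>Varieties contain only structures on \<open>nat\<close>, so every countable example
  enters them through this isomorphic copy.\<close>

definition nat_copy :: "'a invsg \<Rightarrow> nat invsg" where
  "nat_copy S = (let f = to_nat_on (carrier S); g = inv_into (carrier S) f in
    \<lparr>carrier = f ` carrier S, mul = (\<lambda>a b. f (mul S (g a) (g b))), invol = (\<lambda>a. f (invol S (g a)))\<rparr>)"

lemma (in involutory_semigroup) nat_copy: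
  assumes "countable (carrier S)"
  shows involutory_semigroup_nat_copy: "involutory_semigroup (nat_copy S)"
    and holds_in_nat_copy: "u \<noteq> [] \<Longrightarrow> v \<noteq> [] \<Longrightarrow> holds_in (u, v) (nat_copy S) \<longleftrightarrow> holds_in (u, v) S"
    and finite_nat_copy: "finite (carrier (nat_copy S)) \<longleftrightarrow> finite (carrier S)"
    and finitely_generated_nat_copy: "finitely_generated S \<Longrightarrow> finitely_generated (nat_copy S)"
proof -
  define f where "f = to_nat_on (carrier S)"
  define g where "g = inv_into (carrier S) f"
  have inj: "inj_on f (carrier S)"
    unfolding f_def using assms by (rule inj_on_to_nat_on)
  have gf: "g (f a) = a" if "a \<in> carrier S" for a
    unfolding g_def using inj that by simp
  have eq: "f a = f b \<longleftrightarrow> a = b" if "a \<in> carrier S" "b \<in> carrier S" for a b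
    using inj that by (simp add: inj_on_eq_iff)
  have T: "nat_copy S = \<lparr>carrier = f ` carrier S, mul = (\<lambda>a b. f (mul S (g a) (g b))),
      invol = (\<lambda>a. f (invol S (g a)))\<rparr>"
    unfolding nat_copy_def f_def g_def Let_def ..
  show inv: "involutory_semigroup (nat_copy S)"
    unfolding T
    by unfold_locales
      (auto simp: gf carrier_nonempty mul_closed invol_closed mul_assoc invol_mul invol_invol)
  interpret T: involutory_semigroup "nat_copy S"
    by (fact inv)
  have val: "word_val (nat_copy S) (\<lambda>x. f (a x)) w = f (word_val S a w)"
    if "\<And>x. a x \<in> carrier S" "w \<noteq> []" for a w
    using that(2)
  proof (induction w rule: list_nonempty_induct)
    case (single l)
    show ?case by (cases l) (simp_all add: T gf that)
  next
    case (cons l w)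
    have "letter_val (nat_copy S) (\<lambda>x. f (a x)) l = f (letter_val S a l)"
      by (cases l) (simp_all add: T gf that)
    then show ?case
      using cons
      by (simp add: word_val_Cons) (simp add: T gf letter_val_closed word_val_closed that)
  qed
  show "holds_in (u, v) (nat_copy S) \<longleftrightarrow> holds_in (u, v) S" if uv: "u \<noteq> []" "v \<noteq> []"
  proof
    assume *: "holds_in (u, v) (nat_copy S)"
    show "holds_in (u, v) S"
      unfolding holds_in_iff[OF uv]
    proof (intro allI impI)
      fix a :: "nat \<Rightarrow> 'a" assume a: "\<forall>x. a x \<in> carrier S"
      then have "\<forall>x. f (a x) \<in> carrier (nat_copy S)"
        by (simp add: T)
      then have "f (word_val S a u) = f (word_val S a v)"
        using * val a uv unfolding T.holds_in_iff[OF uv] by metis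
      then show "word_val S a u = word_val S a v"
        using eq word_val_closed a uv by auto
    qed
  next
    assume *: "holds_in (u, v) S"
    show "holds_in (u, v) (nat_copy S)"
      unfolding T.holds_in_iff[OF uv]
    proof (intro allI impI)
      fix b :: "nat \<Rightarrow> nat" assume b: "\<forall>x. b x \<in> carrier (nat_copy S)"
      then have g: "\<And>x. g (b x) \<in> carrier S" "(\<lambda>x. f (g (b x))) = b"
        by (auto simp: T g_def inv_into_into f_inv_into_f)
      show "word_val (nat_copy S) b u = word_val (nat_copy S) b v"
        using val[of "\<lambda>x. g (b x)"] g uv * unfolding holds_in_iff[OF uv] by simp
    qed
  qed
  show "finite (carrier (nat_copy S)) \<longleftrightarrow> finite (carrier S)"
    unfolding T using finite_image_iff[OF inj] by simp
  show "finitely_generated (nat_copy S)" if "finitely_generated S"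
  proof -
    obtain G where G: "finite G" "G \<subseteq> carrier S" "invsg_generate S G = carrier S"
      using \<open>finitely_generated S\<close> unfolding finitely_generated_def by blast
    have "a \<in> carrier S \<and> f a \<in> invsg_generate (nat_copy S) (f ` G)" if "a \<in> invsg_generate S G" for a
      using that
    proof induction
      case (gen a)
      then show ?case using G by (auto intro: invsg_generate.gen)
    next
      case (gen_mul a b)
      then show ?case
        using invsg_generate.gen_mul[of "f a" "nat_copy S" "f ` G" "f b"]
        by (auto simp: T gf mul_closed)
    next
      case (gen_invol a)
      then show ?case
        using invsg_generate.gen_invol[of "f a" "nat_copy S" "f ` G"]
        by (auto simp: T gf invol_closed)
    qed
    moreover have "b \<in> carrier (nat_copy S)" if "b \<in> invsg_generate (nat_copy S) (f ` G)" for b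
      using that by induction (use G in \<open>auto simp: T gf mul_closed invol_closed\<close>)
    ultimately have "invsg_generate (nat_copy S) (f ` G) = carrier (nat_copy S)"
      using G(3) by (auto simp: T)
    then show ?thesis
      unfolding finitely_generated_def using G by (intro exI[of _ "f ` G"]) (auto simp: T)
  qed
qed

lemma mem_variety_generated_by:
  assumes "involutory_semigroup T" "countable (carrier T)"
    and "\<And>e. e \<in> identities_of S \<Longrightarrow> holds_in e T"
  shows "nat_copy T \<in> variety_generated_by S"
  unfolding variety_generated_by_def variety_defined_by_def
  using assms involutory_semigroup.nat_copy[OF assms(1,2)]
  by (auto simp: identities_of_def identities_def free_invsg_def)

text \<open>An identity that fails in \<open>S\<close> fails in the subsemigroup of the values of all words, which is
  countable.\<close>

lemma variety_generated_by_identities: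
  fixes S :: "'a invsg"
  assumes "involutory_semigroup S" "e \<in> identities"
    and hold: "\<And>T. T \<in> variety_generated_by S \<Longrightarrow> holds_in e T"
  shows "holds_in e S"
proof -
  interpret involutory_semigroup S by fact
  obtain u v where e: "e = (u, v)" and uv: "u \<noteq> []" "v \<noteq> []"
    using assms(2) by (auto simp: identities_def free_invsg_def)
  show ?thesis
    unfolding e holds_in_iff[OF uv]
  proof (intro allI impI)
    fix a :: "nat \<Rightarrow> 'a" assume a: "\<forall>x. a x \<in> carrier S"
    define C where "C = word_val S a ` {w. w \<noteq> []}"
    define T where "T = S\<lparr>carrier := C\<rparr>"
    have CS: "C \<subseteq> carrier S"
      using a by (auto simp: C_def word_val_closed)
    have C_mul: "mul S b c \<in> C" if "b \<in> C" "c \<in> C" for b c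
    proof -
      obtain v w where "b = word_val S a v" "v \<noteq> []" "c = word_val S a w" "w \<noteq> []"
        using \<open>b \<in> C\<close> \<open>c \<in> C\<close> by (auto simp: C_def)
      then show ?thesis
        using a by (auto simp: C_def word_val_append intro!: image_eqI[of _ _ "v @ w"])
    qed
    have C_inv: "invol S b \<in> C" if "b \<in> C" for b
    proof -
      obtain v where "b = word_val S a v" "v \<noteq> []"
        using \<open>b \<in> C\<close> by (auto simp: C_def)
      then show ?thesis
        using a by (auto simp: C_def word_val_star intro!: image_eqI[of _ _ "rev (map letter_star v)"])
    qed
    have a_C: "a x \<in> C" for x
      unfolding C_def by (rule image_eqI[of _ _ "[Var x]"]) auto
    have T_inv: "involutory_semigroup T"
      using CS a_C
      by unfold_locales
        (auto simp: T_def C_mul C_inv mul_assoc invol_mul invol_invol subset_iff)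
    interpret T: involutory_semigroup T by (fact T_inv)
    have val: "word_val T b w = word_val S b w" for b w
    proof (induction w rule: induct_list012)
      case (2 l)
      show ?case by (cases l) (simp_all add: T_def)
    next
      case (3 l l' w)
      then show ?case by (cases l) (simp_all add: T_def)
    qed simp
    have "holds_in e' T" if mem: "e' \<in> identities_of S" for e'
    proof -
      obtain u' v' where e': "e' = (u', v')" "u' \<noteq> []" "v' \<noteq> []" "holds_in (u', v') S"
        using mem by (cases e') (auto simp: identities_of_def identities_def free_invsg_def)
      then show ?thesis
        using CS unfolding e'(1) T.holds_in_iff[OF e'(2,3)] holds_in_iff[OF e'(2,3)] val
        by (auto simp: T_def)
    qed
    moreover have countT: "countable (carrier T)"
    proof -
      have "countable (UNIV :: letter set)"
      proof (rule countable_subset)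
        show "countable (Var ` UNIV \<union> VarStar ` UNIV)" by auto
        show "UNIV \<subseteq> Var ` UNIV \<union> VarStar ` UNIV"
          by (metis UnCI letter.exhaust rangeI subsetI)
      qed
      then have "countable (lists (UNIV :: letter set))"
        by (rule countable_lists)
      then show ?thesis
        unfolding T_def C_def by (auto intro: countable_subset)
    qed
    ultimately have "holds_in e (nat_copy T)"
      using hold mem_variety_generated_by[OF T_inv] by blast
    then have "holds_in (u, v) T"
      using T.holds_in_nat_copy[OF countT uv] e by simp
    then show "word_val S a u = word_val S a v"
      unfolding T.holds_in_iff[OF uv] val using a_C by (simp add: T_def)
  qed
qed

lemma finite_basis_identities:
  assumes "involutory_semigroup S" "\<Sigma> \<subseteq> identities" "variety_generated_by S \<subseteq> variety_defined_by \<Sigma>"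
  shows "\<Sigma> \<subseteq> identities_of S"
  using variety_generated_by_identities[OF assms(1)] assms(2,3)
  by (fastforce simp: identities_of_def variety_defined_by_def)

subsection \<open>Semigroups of factors\<close>

definition factor_language :: "'b list set \<Rightarrow> bool" where
  "factor_language L \<longleftrightarrow> [] \<notin> L \<and> (\<forall>p w s. p @ w @ s \<in> L \<longrightarrow> w \<noteq> [] \<longrightarrow> w \<in> L)"

lemma factor_languageD: "\<lbrakk>factor_language L; p @ w @ s \<in> L; w \<noteq> []\<rbrakk> \<Longrightarrow> w \<in> L"
  unfolding factor_language_def by blast

text \<open>\<open>None\<close> is the zero, \<open>Some (False, w)\<close> the word \<open>w\<close>, and \<open>Some (True, w)\<close> its image under
  the involution.\<close>

definition factor_sg :: "'b list set \<Rightarrow> (bool \<times> 'b list) option invsg" where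
  "factor_sg L =
    \<lparr>carrier = insert None ((\<lambda>(b, w). Some (b, w)) ` (UNIV \<times> L)),
     mul = (\<lambda>x y. case (x, y) of
        (Some (b, v), Some (c, w)) \<Rightarrow>
          (let z = if b then w @ v else v @ w in if b = c \<and> z \<in> L then Some (b, z) else None)
      | _ \<Rightarrow> None),
     invol = map_option (\<lambda>(b, w). (\<not> b, w))\<rparr>"

lemma factor_sg_carrier: "x \<in> carrier (factor_sg L) \<longleftrightarrow> x = None \<or> (\<exists>b w. x = Some (b, w) \<and> w \<in> L)"
  by (auto simp: factor_sg_def)

lemma factor_sg_cases:
  obtains "x = None" | b w where "x = Some (b, w)"
  by (cases x) auto

lemma factor_sg_mul [simp]:
  "mul (factor_sg L) (Some (b, v)) (Some (c, w)) =
    (if b = c \<and> (if b then w @ v else v @ w) \<in> L then Some (b, if b then w @ v else v @ w) else None)"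
  "mul (factor_sg L) None y = None"
  "mul (factor_sg L) x None = None"
  by (auto simp: factor_sg_def Let_def split: option.splits)

lemma factor_sg_invol [simp]:
  "invol (factor_sg L) (Some (b, w)) = Some (\<not> b, w)"
  "invol (factor_sg L) None = None"
  by (auto simp: factor_sg_def)

lemma involutory_semigroup_factor_sg:
  assumes "factor_language L"
  shows "involutory_semigroup (factor_sg L)"
proof
  show "carrier (factor_sg L) \<noteq> {}"
    by (auto simp: factor_sg_def)
next
  fix x y :: "(bool \<times> 'a list) option"
  assume xy: "x \<in> carrier (factor_sg L)" "y \<in> carrier (factor_sg L)"
  show "mul (factor_sg L) x y \<in> carrier (factor_sg L)"
    unfolding factor_sg_carrier
    by (cases x rule: factor_sg_cases; cases y rule: factor_sg_cases) simp_all
  show "invol (factor_sg L) (mul (factor_sg L) x y) =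
      mul (factor_sg L) (invol (factor_sg L) y) (invol (factor_sg L) x)"
    by (cases x rule: factor_sg_cases; cases y rule: factor_sg_cases) simp_all
next
  fix x y z :: "(bool \<times> 'a list) option"
  assume xyz: "x \<in> carrier (factor_sg L)" "y \<in> carrier (factor_sg L)" "z \<in> carrier (factor_sg L)"
  \<comment> \<open>A product of three words can be nonzero only if the whole word lies in
    \<open>L\<close>; closure under factors then makes both partial products nonzero.\<close>
  have pre: "u @ v \<in> L" if "u @ v @ w \<in> L" "u \<in> L" for u v w
    using factor_languageD[OF assms, of "[]" "u @ v" w] that assms by (auto simp: factor_language_def)
  have suf: "v @ w \<in> L" if "u @ v @ w \<in> L" "w \<in> L" for u v w
    using factor_languageD[OF assms, of u "v @ w" "[]"] that assms by (auto simp: factor_language_def)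
  show "mul (factor_sg L) (mul (factor_sg L) x y) z = mul (factor_sg L) x (mul (factor_sg L) y z)"
  proof (cases "x = None \<or> y = None \<or> z = None")
    case False
    then obtain b u c v d w where eq: "x = Some (b, u)" "y = Some (c, v)" "z = Some (d, w)"
      and L: "u \<in> L" "v \<in> L" "w \<in> L"
      using xyz by (auto simp: factor_sg_carrier)
    show ?thesis
      using pre[of u v w] suf[of u v w] pre[of w v u] suf[of w v u] L
      unfolding eq by (cases b; cases c; cases d) simp_all
  qed auto
next
  fix x :: "(bool \<times> 'a list) option"
  assume x: "x \<in> carrier (factor_sg L)"
  show "invol (factor_sg L) x \<in> carrier (factor_sg L)"
    using x by (auto simp: factor_sg_carrier)
  show "invol (factor_sg L) (invol (factor_sg L) x) = x"
    using x by (auto simp: factor_sg_carrier)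
qed

lemma factor_sg_word_val:
  assumes "factor_language L" "w \<noteq> []" "\<And>x. a x \<in> carrier (factor_sg L)"
    and "word_val (factor_sg L) a w = Some (False, z)"
  shows "z \<in> L \<and> (\<forall>l\<in>set w. \<exists>y\<in>L. letter_val (factor_sg L) a l = Some (False, y)) \<and>
    z = concat (map (\<lambda>l. snd (the (letter_val (factor_sg L) a l))) w)"
  using assms(2,4)
proof (induction w arbitrary: z rule: list_nonempty_induct)
  case (single l)
  have "letter_val (factor_sg L) a l \<in> carrier (factor_sg L)"
    using involutory_semigroup.letter_val_closed[OF involutory_semigroup_factor_sg] assms by blast
  with single show ?case
    by (auto simp: factor_sg_carrier)
next
  case (cons l w)
  interpret involutory_semigroup "factor_sg L"
    using assms(1) by (rule involutory_semigroup_factor_sg)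
  have l: "letter_val (factor_sg L) a l \<in> carrier (factor_sg L)"
    using letter_val_closed assms by blast
  obtain b y c z' where *: "letter_val (factor_sg L) a l = Some (b, y)"
      "word_val (factor_sg L) a w = Some (c, z')"
    using cons.prems cons.hyps
    by (cases "letter_val (factor_sg L) a l"; cases "word_val (factor_sg L) a w")
      (auto simp: word_val_Cons)
  then have "\<not> b" "\<not> c" "y \<in> L" "z = y @ z'" "z \<in> L"
    using cons.prems cons.hyps l by (auto simp: word_val_Cons factor_sg_carrier split: if_splits)
  with cons.IH[of z'] * show ?case
    by auto
qed

section \<open>Isoterms and rigid languages\<close>

fun letter_var :: "letter \<Rightarrow> nat" where
  "letter_var (Var x) = x"
| "letter_var (VarStar x) = x"

definition isoterm :: "'a invsg \<Rightarrow> letter list \<Rightarrow> bool" where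
  "isoterm S u \<longleftrightarrow> (\<forall>v. v \<noteq> [] \<longrightarrow> holds_in (u, v) S \<longrightarrow> v = u)"

definition rigid :: "'a invsg \<Rightarrow> nat \<Rightarrow> 'b list set \<Rightarrow> bool" where
  "rigid S k L \<longleftrightarrow> (\<forall>(u::nat list) (\<phi>::nat \<Rightarrow> 'b list).
     u \<noteq> [] \<longrightarrow> card (set u) \<le> k \<longrightarrow> (\<forall>x\<in>set u. \<phi> x \<noteq> []) \<longrightarrow> concat (map \<phi> u) \<in> L
     \<longrightarrow> isoterm S (map Var u))"

text \<open>No variable occurs in \<open>u\<close> both with and without star, since its two values
  would differ in kind. Exchanging the starred variables with their stars, by \<open>flip\<close>,
  preserves identities and turns \<open>u\<close> into a plain word to which rigidity
  applies.\<close>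

lemma rigid_isoterm:
  assumes S: "involutory_semigroup S" and L: "factor_language L" and rig: "rigid S k L"
    and u: "u \<noteq> []" "card (letter_var ` set u) \<le> k" and v: "v \<noteq> []"
    and hold: "holds_in (u, v) S"
    and a: "\<And>x. a x \<in> carrier (factor_sg L)"
    and val: "word_val (factor_sg L) a u = Some (False, z)"
  shows "v = u"
proof -
  interpret involutory_semigroup S by fact
  note fv = factor_sg_word_val[OF L u(1) a val]
  define X where "X = {x. VarStar x \<in> set u}"
  define flip where "flip l = (if letter_var l \<in> X then letter_star l else l)" for l
  have flip_flip: "flip (flip l) = l" for l
    by (cases l) (auto simp: flip_def)
  have pos: "flip l = Var (letter_var l)" if l: "l \<in> set u" for l
  proof (cases l)
    case (Var x)
    have "x \<notin> X"
    proof
      assume "x \<in> X"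
      then have "VarStar x \<in> set u" by (simp add: X_def)
      then obtain y y' where "letter_val (factor_sg L) a (VarStar x) = Some (False, y)"
          "letter_val (factor_sg L) a (Var x) = Some (False, y')"
        using fv l unfolding Var by meson
      then show False
        by simp
    qed
    then show ?thesis by (simp add: flip_def Var)
  next
    case (VarStar x)
    then show ?thesis using that by (simp add: flip_def X_def)
  qed
  define u' where "u' = map letter_var u"
  have u': "map flip u = map Var u'"
    using pos by (simp add: u'_def)
  define \<phi> where "\<phi> x = snd (the (letter_val (factor_sg L) a (flip (Var x))))" for x
  have phi: "\<phi> (letter_var l) = snd (the (letter_val (factor_sg L) a l))" if "l \<in> set u" for l
    using pos[OF that] flip_flip[of l] by (simp add: \<phi>_def)
  have "concat (map \<phi> u') = z"
    using fv phi by (auto simp: u'_def comp_def intro!: arg_cong[of _ _ concat])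
  moreover have "\<forall>x\<in>set u'. \<phi> x \<noteq> []"
    using fv phi L by (fastforce simp: u'_def factor_language_def)
  ultimately have "isoterm S (map flip u)"
    using rig u fv unfolding u' rigid_def by (auto simp: u'_def)
  moreover have "holds_in (map flip u, map flip v) S"
  proof -
    have flip_val: "word_val S b (map flip w) =
        word_val S (\<lambda>x. if x \<in> X then invol S (b x) else b x) w"
      if b: "\<And>x. b x \<in> carrier S" for b w
    proof (induction w rule: induct_list012)
      case (2 l)
      show ?case by (cases l) (auto simp: flip_def invol_invol b)
    next
      case (3 l l' w)
      then show ?case by (cases l) (auto simp: flip_def invol_invol b)
    qed simp
    show ?thesis
      using hold u v flip_val by (simp add: holds_in_iff invol_closed)
  qed
  ultimately have "map flip v = map flip u"
    using v by (auto simp: isoterm_def)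
  then have "map (flip \<circ> flip) v = map (flip \<circ> flip) u"
    by (metis list.map_comp)
  then show ?thesis
    by (simp add: comp_def flip_flip)
qed

lemma holds_in_sym: "holds_in (u, v) S \<longleftrightarrow> holds_in (v, u) S"
  by (auto simp: holds_in_def)

text \<open>If one side has a nonzero value, that side is an isoterm and both sides coincide;
  otherwise both values are zero. A starred value is made unstarred by applying the involution to
  both sides of the identity.\<close>

lemma rigid_holds_in:
  assumes S: "involutory_semigroup S" and L: "factor_language L" and rig: "rigid S k L"
    and e: "(u, v) \<in> identities_of S"
    and card: "card (letter_var ` set u) \<le> k" "card (letter_var ` set v) \<le> k"
  shows "holds_in (u, v) (factor_sg L)"
proof -
  interpret F: involutory_semigroup "factor_sg L"
    using L by (rule involutory_semigroup_factor_sg)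
  interpret involutory_semigroup S by fact
  have uv: "u \<noteq> []" "v \<noteq> []" "holds_in (u, v) S"
    using e by (auto simp: identities_of_def identities_def free_invsg_def)
  define st where "st = (\<lambda>w. rev (map letter_star w))"
  have st: "st w = [] \<longleftrightarrow> w = []" "letter_var ` set (st w) = letter_var ` set w" "st (st w) = w" for w
  proof -
    have "letter_var (letter_star l) = letter_var l" for l by (cases l) auto
    then show "letter_var ` set (st w) = letter_var ` set w" by (simp add: st_def image_image)
  qed (auto simp: st_def rev_map comp_def)
  have st_hold: "holds_in (st u, st v) S"
    using uv unfolding holds_in_iff[OF uv(1,2)]
    by (subst holds_in_iff) (auto simp: st word_val_star st_def)
  have main: "u = v" if a: "\<And>x. a x \<in> carrier (factor_sg L)"
    and uv: "u \<noteq> []" "v \<noteq> []" "holds_in (u, v) S" "holds_in (st u, st v) S"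
    and card: "card (letter_var ` set u) \<le> k"
    and val: "word_val (factor_sg L) a u \<noteq> None" for a u v
  proof -
    obtain b z where z: "word_val (factor_sg L) a u = Some (b, z)"
      using val by fastforce
    show ?thesis
    proof (cases b)
      case False
      then show ?thesis
        using rigid_isoterm[OF S L rig uv(1) card uv(2,3) a] z by simp
    next
      case True
      then have "word_val (factor_sg L) a (st u) = Some (False, z)"
        using F.word_val_star[OF a uv(1)] z by (simp add: st_def)
      then have "st v = st u"
        using rigid_isoterm[OF S L rig _ _ _ uv(4) a] uv card by (simp add: st)
      then show ?thesis by (metis st(3))
    qed
  qed
  show ?thesis
    unfolding F.holds_in_iff[OF uv(1,2)]
  proof (intro allI impI)
    fix a :: "nat \<Rightarrow> (bool \<times> 'b list) option"
    assume a: "\<forall>x. a x \<in> carrier (factor_sg L)"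
    show "word_val (factor_sg L) a u = word_val (factor_sg L) a v"
      using main[of a u v] main[of a v u] a uv st_hold card holds_in_sym[of u v] holds_in_sym[of "st u"]
      by (metis (no_types, lifting))
  qed
qed

section \<open>Criteria for the lack of a finite basis\<close>

lemma countable_factor_sg: "countable (carrier (factor_sg (L :: 'b::countable list set)))"
  by simp

lemma finite_variables_bound:
  assumes "finite \<Sigma>"
  obtains k where "\<And>u v. (u, v) \<in> \<Sigma> \<Longrightarrow> card (letter_var ` set u) \<le> k \<and> card (letter_var ` set v) \<le> k"
proof
  fix u v assume "(u, v) \<in> \<Sigma>"
  then have "card (letter_var ` set u) + card (letter_var ` set v) \<le>
      (\<Sum>(u, v)\<in>\<Sigma>. card (letter_var ` set u) + card (letter_var ` set v))"
    using member_le_sum[of "(u, v)" \<Sigma> "\<lambda>(u, v). card (letter_var ` set u) + card (letter_var ` set v)"]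
      assms by auto
  then show "card (letter_var ` set u) \<le>
        (\<Sum>(u, v)\<in>\<Sigma>. card (letter_var ` set u) + card (letter_var ` set v)) \<and>
      card (letter_var ` set v) \<le>
        (\<Sum>(u, v)\<in>\<Sigma>. card (letter_var ` set u) + card (letter_var ` set v))"
    by simp
qed

lemma factor_sg_mem_variety:
  fixes L :: "'b::countable list set"
  assumes S: "involutory_semigroup S" and L: "factor_language L" and rig: "rigid S k L"
    and \<Sigma>: "\<Sigma> \<subseteq> identities_of S"
    and k: "\<And>u v. (u, v) \<in> \<Sigma> \<Longrightarrow> card (letter_var ` set u) \<le> k \<and> card (letter_var ` set v) \<le> k"
  shows "nat_copy (factor_sg L) \<in> variety_defined_by \<Sigma>"
proof -
  interpret F: involutory_semigroup "factor_sg L"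
    using L by (rule involutory_semigroup_factor_sg)
  have "holds_in e (nat_copy (factor_sg L))" if e: "e \<in> \<Sigma>" for e
  proof -
    obtain u v where uv: "e = (u, v)" "u \<noteq> []" "v \<noteq> []"
      using e \<Sigma> by (cases e) (auto simp: identities_of_def identities_def free_invsg_def)
    have "holds_in (u, v) (factor_sg L)"
      using rigid_holds_in[OF S L rig] e \<Sigma> k uv by blast
    then show ?thesis
      using F.holds_in_nat_copy[OF countable_factor_sg uv(2,3)] uv by simp
  qed
  then show ?thesis
    using F.involutory_semigroup_nat_copy[OF countable_factor_sg] by (simp add: variety_defined_by_def)
qed

lemma factor_sg_finitely_generated:
  assumes L: "factor_language L" and A: "finite A" "L \<subseteq> lists A"
  shows "finitely_generated (factor_sg L)"
proof -
  interpret F: involutory_semigroup "factor_sg L"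
    using L by (rule involutory_semigroup_factor_sg)
  define G where "G = insert None ((\<lambda>a. Some (False, [a])) ` {a\<in>A. [a] \<in> L})"
  have GF: "G \<subseteq> carrier (factor_sg L)"
    by (auto simp: G_def factor_sg_carrier)
  have *: "Some (False, w) \<in> invsg_generate (factor_sg L) G" if "w \<in> L" for w
    using that
  proof (induction w)
    case Nil
    then show ?case using L by (simp add: factor_language_def)
  next
    case (Cons a w)
    have a: "[a] \<in> L" "a \<in> A"
      using factor_languageD[OF L, of "[]" "[a]" w] Cons.prems A by auto
    then have ga: "Some (False, [a]) \<in> invsg_generate (factor_sg L) G"
      by (intro invsg_generate.gen) (simp add: G_def)
    show ?case
    proof (cases "w = []")
      case False
      then have "w \<in> L"
        using factor_languageD[OF L, of "[a]" w "[]"] Cons.prems by simp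
      then show ?thesis
        using invsg_generate.gen_mul[OF ga Cons.IH] Cons.prems by simp
    qed (use ga in simp)
  qed
  have "Some (b, w) \<in> invsg_generate (factor_sg L) G" if "w \<in> L" for b w
    using *[OF that] invsg_generate.gen_invol[OF *[OF that]] by (cases b) auto
  then have "carrier (factor_sg L) \<subseteq> invsg_generate (factor_sg L) G"
    using invsg_generate.gen[of None G] by (auto simp: factor_sg_carrier G_def)
  moreover have "x \<in> carrier (factor_sg L)" if "x \<in> invsg_generate (factor_sg L) G" for x
    using that by induction (use GF in \<open>auto intro: F.mul_closed F.invol_closed\<close>)
  ultimately show ?thesis
    unfolding finitely_generated_def using A GF by (intro exI[of _ G]) (auto simp: G_def)
qed

text \<open>A finite basis bounds the number of variables by some \<open>k\<close>, so a larger
  finitely based variety contains \<open>factor_sg L\<close> for the language belonging to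
  \<open>k\<close>. This semigroup is finitely generated, by zero and single letters, yet infinite,
  against local finiteness.\<close>

lemma inherently_nonfinitely_basedI:
  fixes S :: "'a invsg"
  assumes S: "involutory_semigroup S"
    and lf: "locally_finite_variety (variety_generated_by S)"
    and ex: "\<And>k. \<exists>(L :: 'b::countable list set) A.
      factor_language L \<and> rigid S k L \<and> finite A \<and> L \<subseteq> lists A \<and> infinite L"
  shows "inherently_nonfinitely_based S"
  unfolding inherently_nonfinitely_based_def inherently_nonfinitely_based_variety_def
proof (intro conjI lf notI)
  assume "\<exists>W. is_variety W \<and> finitely_based_variety W \<and> locally_finite_variety W
    \<and> variety_generated_by S \<subseteq> W"
  then obtain \<Sigma> where \<Sigma>: "\<Sigma> \<subseteq> identities" "finite \<Sigma>"
      "locally_finite_variety (variety_defined_by \<Sigma>)" "variety_generated_by S \<subseteq> variety_defined_by \<Sigma>"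
    unfolding finitely_based_variety_def by blast
  obtain k where k: "\<And>u v. (u, v) \<in> \<Sigma> \<Longrightarrow>
      card (letter_var ` set u) \<le> k \<and> card (letter_var ` set v) \<le> k"
    using finite_variables_bound[OF \<Sigma>(2)] by blast
  obtain L :: "'b list set" and A where L: "factor_language L" "rigid S k L" "finite A" "L \<subseteq> lists A" "infinite L"
    using ex by blast
  interpret F: involutory_semigroup "factor_sg L"
    using L(1) by (rule involutory_semigroup_factor_sg)
  have "nat_copy (factor_sg L) \<in> variety_defined_by \<Sigma>"
    using factor_sg_mem_variety[OF S L(1,2) finite_basis_identities[OF S \<Sigma>(1,4)] k] .
  moreover have "finitely_generated (nat_copy (factor_sg L))"
    using F.finitely_generated_nat_copy[OF countable_factor_sg] factor_sg_finitely_generated[OF L(1,3,4)] .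
  ultimately have "finite (carrier (nat_copy (factor_sg L)))"
    using \<Sigma>(3) by (simp add: locally_finite_variety_def)
  then have "finite (carrier (factor_sg L))"
    using F.finite_nat_copy[OF countable_factor_sg] by simp
  then have "finite ((\<lambda>w. Some (False, w)) ` L)"
    by (rule rev_finite_subset) (auto simp: factor_sg_carrier)
  then show False
    using L(5) by (simp add: finite_image_iff inj_on_def)
qed

text \<open>A finite basis would put \<open>factor_sg L\<close> into the variety generated by
  \<open>S\<close>, where \<open>f\<close> and \<open>f'\<close> must have equal values under every
  assignment; sending each letter of \<open>L\<close> to itself separates them.\<close>

lemma nonfinitely_basedI:
  fixes S :: "'a invsg"
  assumes S: "involutory_semigroup S"
    and ex: "\<And>k. \<exists>(L :: 'b::countable list set) f f'. factor_language L \<and> rigid S k L \<and> f \<in> L \<and>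
      f' \<noteq> f \<and> (map (Var \<circ> to_nat) f, map (Var \<circ> to_nat) f') \<in> identities_of S"
  shows "nonfinitely_based S"
  unfolding nonfinitely_based_def finitely_based_variety_def
proof
  assume "\<exists>\<Sigma>\<subseteq>identities. finite \<Sigma> \<and> variety_generated_by S = variety_defined_by \<Sigma>"
  then obtain \<Sigma> where \<Sigma>: "\<Sigma> \<subseteq> identities" "finite \<Sigma>" "variety_generated_by S = variety_defined_by \<Sigma>"
    by blast
  obtain k where k: "\<And>u v. (u, v) \<in> \<Sigma> \<Longrightarrow>
      card (letter_var ` set u) \<le> k \<and> card (letter_var ` set v) \<le> k"
    using finite_variables_bound[OF \<Sigma>(2)] by blast
  define enc :: "'b list \<Rightarrow> letter list" where "enc = map (Var \<circ> to_nat)"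
  obtain L :: "'b list set" and f f' where L: "factor_language L" "rigid S k L" "f \<in> L" "f' \<noteq> f"
    and id: "(enc f, enc f') \<in> identities_of S"
    using ex unfolding enc_def by blast
  interpret F: involutory_semigroup "factor_sg L"
    using L(1) by (rule involutory_semigroup_factor_sg)
  have ne: "enc f \<noteq> []" "enc f' \<noteq> []"
    using id by (auto simp: identities_of_def identities_def free_invsg_def)
  have "nat_copy (factor_sg L) \<in> variety_generated_by S"
    unfolding \<Sigma>(3)
    using factor_sg_mem_variety[OF S L(1,2) finite_basis_identities[OF S \<Sigma>(1)] k] \<Sigma>(3) by simp
  then have "holds_in (enc f, enc f') (nat_copy (factor_sg L))"
    using id by (simp add: variety_generated_by_def variety_defined_by_def)
  then have hold: "holds_in (enc f, enc f') (factor_sg L)"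
    using F.holds_in_nat_copy[OF countable_factor_sg ne] by simp
  define a where "a x = (if [from_nat x] \<in> L then Some (False, [from_nat x :: 'b]) else None)" for x
  have a: "\<forall>x. a x \<in> carrier (factor_sg L)"
    by (auto simp: a_def factor_sg_carrier)
  have val: "word_val (factor_sg L) a (enc w) = (if w \<in> L then Some (False, w) else None)"
    if "w \<noteq> []" for w
    using that
  proof (induction w rule: list_nonempty_induct)
    case (single b)
    then show ?case by (simp add: enc_def a_def)
  next
    case (cons b w)
    have "[b] \<in> L" "w \<in> L" if "b # w \<in> L"
      using that factor_languageD[OF L(1), of "[]" "[b]" w] factor_languageD[OF L(1), of "[b]" w "[]"]
        cons.hyps by auto
    then show ?case
      using cons by (auto simp: enc_def a_def word_val_Cons)
  qed
  have "word_val (factor_sg L) a (enc f) = word_val (factor_sg L) a (enc f')"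
    using hold a unfolding F.holds_in_iff[OF ne] by blast
  then show False
    using val[of f] val[of f'] L(3,4) ne by (auto simp: enc_def split: if_splits)
qed

subsection \<open>Identities of triangular matrices\<close>

text \<open>The matrices form a monoid, so here the empty word has a value; this allows variables to
  be deleted.\<close>

definition mat_val :: "nat \<Rightarrow> (nat \<Rightarrow> 'a::field mat) \<Rightarrow> letter list \<Rightarrow> 'a mat" where
  "mat_val n M w = foldr (\<lambda>l A. letter_val (UpmT n) M l * A) w (1\<^sub>m n)"

definition mat_identity :: "'a::field itself \<Rightarrow> nat \<Rightarrow> letter list \<Rightarrow> letter list \<Rightarrow> bool" where
  "mat_identity _ n u v \<longleftrightarrow> (\<forall>M :: nat \<Rightarrow> 'a mat. (\<forall>x. M x \<in> carrier (UpmT n)) \<longrightarrow> mat_val n M u = mat_val n M v)"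

lemma mat_val_simps [simp]:
  "mat_val n M [] = 1\<^sub>m n"
  "mat_val n M (l # w) = letter_val (UpmT n) M l * mat_val n M w"
  by (simp_all add: mat_val_def)

lemma carrier_UpmT:
  "A \<in> carrier (UpmT n) \<longleftrightarrow>
    A \<in> carrier_mat n n \<and> upper_triangular A \<and> (\<forall>i<n. A $$ (i, i) \<in> {0, 1, -1})"
  by (auto simp: UpmT_def)

lemma mul_UpmT [simp]: "mul (UpmT n) A B = A * B"
  by (simp add: UpmT_def)

lemma one_UpmT: "1\<^sub>m n \<in> carrier (UpmT n)"
  by (auto simp: carrier_UpmT)

lemma skew_transpose_one: "skew_transpose n (1\<^sub>m n) = 1\<^sub>m n"
  by (rule eq_matI) (auto simp: skew_transpose_def)

lemma letter_val_UpmT: "(\<And>x. M x \<in> carrier (UpmT n)) \<Longrightarrow> letter_val (UpmT n) M l \<in> carrier (UpmT n)"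
  by (rule involutory_semigroup.letter_val_closed[OF involutory_semigroup_UpmT])

lemma mat_val_UpmT:
  assumes "\<And>x. M x \<in> carrier (UpmT n)"
  shows "mat_val n M w \<in> carrier (UpmT n)"
proof (induction w)
  case (Cons l w)
  then show ?case
    using involutory_semigroup.mul_closed[OF involutory_semigroup_UpmT letter_val_UpmT[OF assms]]
    by fastforce
qed (simp add: one_UpmT)

lemma mat_val_carrier_mat:
  "(\<And>x. M x \<in> carrier (UpmT n)) \<Longrightarrow> mat_val n M w \<in> carrier_mat n n"
  using mat_val_UpmT carrier_UpmT by blast

lemma letter_val_carrier_mat:
  "(\<And>x. M x \<in> carrier (UpmT n)) \<Longrightarrow> letter_val (UpmT n) M l \<in> carrier_mat n n"
  using letter_val_UpmT carrier_UpmT by blast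

lemma mat_val_append:
  assumes "\<And>x. M x \<in> carrier (UpmT n)"
  shows "mat_val n M (v @ w) = mat_val n M v * mat_val n M w"
proof (induction v)
  case Nil
  then show ?case using mat_val_carrier_mat[of M n w, OF assms] by simp
next
  case (Cons l v)
  then show ?case
    using assoc_mult_mat[OF letter_val_carrier_mat[of M n l, OF assms] mat_val_carrier_mat[of M n v, OF assms]
        mat_val_carrier_mat[of M n w, OF assms]] by simp
qed

lemma word_val_UpmT:
  assumes "\<And>x. M x \<in> carrier (UpmT n)" "w \<noteq> []"
  shows "word_val (UpmT n) M w = mat_val n M w"
  using assms(2)
proof (induction w rule: list_nonempty_induct)
  case (single l)
  then show ?case using letter_val_carrier_mat[of M n l, OF assms(1)] by simp
qed (simp add: word_val_Cons)

lemma holds_in_UpmT: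
  assumes "u \<noteq> []" "v \<noteq> []"
  shows "holds_in (u, v) (UpmT n :: 'a::field mat invsg) \<longleftrightarrow> mat_identity TYPE('a) n u v"
  unfolding involutory_semigroup.holds_in_iff[OF involutory_semigroup_UpmT assms] mat_identity_def
  using word_val_UpmT[OF _ assms(1)] word_val_UpmT[OF _ assms(2)] by metis

lemma mat_identity_wrap:
  assumes "mat_identity TYPE('a::field) n u v"
  shows "mat_identity TYPE('a) n (s @ u @ t) (s @ v @ t)"
  using assms unfolding mat_identity_def by (auto simp: mat_val_append)

text \<open>The identity matrix is fixed by the skew transpose, so assigning it deletes a variable
  with and without star.\<close>

lemma mat_identity_delete:
  assumes "mat_identity TYPE('a::field) n u v"
  shows "mat_identity TYPE('a) n (filter (\<lambda>l. letter_var l \<notin> D) u) (filter (\<lambda>l. letter_var l \<notin> D) v)"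
  unfolding mat_identity_def
proof (intro allI impI)
  fix M :: "nat \<Rightarrow> 'a mat" assume M: "\<forall>x. M x \<in> carrier (UpmT n)"
  define N where "N x = (if x \<in> D then 1\<^sub>m n else M x)" for x
  have N: "\<forall>x. N x \<in> carrier (UpmT n)"
    using M by (simp add: N_def one_UpmT)
  have "mat_val n N w = mat_val n M (filter (\<lambda>l. letter_var l \<notin> D) w)" for w
  proof (induction w)
    case (Cons l w)
    have "letter_val (UpmT n) N l = (if letter_var l \<in> D then 1\<^sub>m n else letter_val (UpmT n) M l)"
      by (cases l) (auto simp: N_def UpmT_def skew_transpose_one)
    then show ?case
      using Cons left_mult_one_mat[OF mat_val_carrier_mat[of M n]] M by simp
  qed simp
  then show "mat_val n M (filter (\<lambda>l. letter_var l \<notin> D) u) = mat_val n M (filter (\<lambda>l. letter_var l \<notin> D) v)"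
    using assms N unfolding mat_identity_def by metis
qed

text \<open>The idempotent with a single entry 1 in the upper left corner and its skew transpose
  separate letters from starred letters.\<close>

lemma mat_identity_unstarred:
  assumes n: "2 \<le> n" and id: "mat_identity TYPE('a::field) n (map Var u) v"
  obtains v' where "v = map Var v'"
proof -
  define E :: "'a mat" where "E = mat n n (\<lambda>(i, j). if i = 0 \<and> j = 0 then 1 else 0)"
  have E: "E \<in> carrier (UpmT n)"
    by (auto simp: carrier_UpmT E_def)
  have *: "mat_val n (\<lambda>_. E) w $$ (0, 0) = (if \<exists>x. VarStar x \<in> set w then 0 else 1)" for w
  proof (induction w)
    case (Cons l w)
    have "letter_val (UpmT n) (\<lambda>_. E) l \<in> carrier (UpmT n)" "mat_val n (\<lambda>_. E) w \<in> carrier (UpmT n)"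
      by (rule letter_val_UpmT mat_val_UpmT, rule E)+
    then have "mat_val n (\<lambda>_. E) (l # w) $$ (0, 0) =
        letter_val (UpmT n) (\<lambda>_. E) l $$ (0, 0) * mat_val n (\<lambda>_. E) w $$ (0, 0)"
      using n upper_triangular_mult_entry[of _ n _ 0 0] by (auto simp: carrier_UpmT)
    also have "letter_val (UpmT n) (\<lambda>_. E) l $$ (0, 0) = (if \<exists>x. l = VarStar x then 0 else 1)"
      using n by (cases l) (auto simp: UpmT_def E_def skew_transpose_def)
    finally show ?case
      using Cons by auto
  qed (use n in auto)
  have "mat_val n (\<lambda>_. E) v = mat_val n (\<lambda>_. E) (map Var u)"
    using id E unfolding mat_identity_def by metis
  then have "\<nexists>x. VarStar x \<in> set v"
    using *[of v] *[of "map Var u"] by (auto split: if_splits)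
  then have "v = map Var (map letter_var v)"
    by (induction v) (auto elim: letter_var.elims, metis letter.exhaust letter_var.simps(1))
  then show ?thesis using that by blast
qed

section \<open>Counting occurrences of factors by the parities before them\<close>

definition occ :: "'a list \<Rightarrow> 'a list \<Rightarrow> nat set" where
  "occ F u = {p. p < length u \<and> take (length F) (drop p u) = F}"

lemma finite_occ [simp]: "finite (occ F u)"
  by (simp add: occ_def)

lemma sum_occ_Cons:
  fixes h :: "nat \<Rightarrow> 'b::comm_monoid_add"
  shows "sum h (occ F (x # u)) =
    (if take (length F) (x # u) = F then h 0 else 0) + (\<Sum>p\<in>occ F u. h (Suc p))"
proof -
  have "occ F (x # u) = {p \<in> {0}. take (length F) (x # u) = F} \<union> Suc ` occ F u"
    by (auto simp: occ_def image_iff less_Suc_eq_0_disj)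
  then have "sum h (occ F (x # u)) =
      sum h {p \<in> {0}. take (length F) (x # u) = F} + sum h (Suc ` occ F u)"
    by (simp only:) (rule sum.union_disjoint, auto)
  then show ?thesis
    by (auto simp: sum.reindex)
qed

text \<open>The product of these matrices along a word has in the corner \<open>(0, n - 1)\<close> the sum, over the
  occurrences of the factor \<open>F\<close>, of the value of \<open>\<chi>\<close> on the prefix before the occurrence.\<close>

definition factor_mat :: "nat \<Rightarrow> nat list \<Rightarrow> (nat \<Rightarrow> 'a) \<Rightarrow> nat \<Rightarrow> 'a::field mat" where
  "factor_mat n F \<chi> x = mat n n (\<lambda>(i, j).
     (if j = i then if i = 0 then \<chi> x else if i = n - 1 then 1 else 0 else 0) +
     (if i < length F \<and> j = (if Suc i < length F then Suc i else n - 1) \<and> F ! i = x then 1 else 0))"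

lemma factor_mat_UpmT:
  assumes "1 \<le> length F" "length F < n" "\<chi> x \<in> {1, -1}"
  shows "factor_mat n F \<chi> x \<in> carrier (UpmT n)"
proof -
  have ut: "upper_triangular (factor_mat n F \<chi> x)"
    using assms(1,2) by (auto simp: factor_mat_def intro!: upper_triangularI)
  have "factor_mat n F \<chi> x $$ (i, i) \<in> {0, 1, -1}" if "i < n" for i
    using assms that by (auto simp: factor_mat_def)
  then show ?thesis
    using ut by (simp add: carrier_UpmT) (simp add: factor_mat_def)
qed

text \<open>The matrices describe an automaton that waits in state \<open>0\<close> with weight
  \<open>\<chi>\<close>, reads \<open>F\<close> through states without loops and then waits in state
  \<open>n - 1\<close> with weight \<open>1\<close>. A run from \<open>0\<close> to
  \<open>n - 1\<close> amounts to an occurrence of \<open>F\<close>.\<close>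

lemma factor_mat_val:
  fixes \<chi> :: "nat \<Rightarrow> 'a::field"
  assumes F: "1 \<le> length F" "length F < n" and \<chi>: "\<And>x. \<chi> x \<in> {1, -1}"
  shows "mat_val n (factor_mat n F \<chi>) (map Var u) $$ (0, n - 1) =
    (\<Sum>p\<in>occ F u. prod_list (map \<chi> (take p u)))"
proof -
  let ?M = "factor_mat n F \<chi>"
  have M: "?M x \<in> carrier (UpmT n)" for x
    using factor_mat_UpmT F \<chi> by blast
  \<comment> \<open>State \<open>e i\<close> is reached after \<open>i\<close> letters of
    \<open>F\<close>; once \<open>F\<close> is complete this is \<open>n - 1\<close>.\<close>
  define e where "e i = (if i < length F then i else n - 1)" for i
  have e0: "e 0 = 0"
    using F by (auto simp: e_def)
  have e: "e i < n" for i
    using F by (auto simp: e_def)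
  have step: "(?M x * A) $$ (e i, n - 1) =
      (if i = 0 then \<chi> x else if length F \<le> i then 1 else 0) * A $$ (e i, n - 1) +
      (if i < length F \<and> F ! i = x then A $$ (e (Suc i), n - 1) else 0)"
    if A: "A \<in> carrier_mat n n" for A x i
  proof -
    have "(?M x * A) $$ (e i, n - 1) = (\<Sum>k<n. ?M x $$ (e i, k) * A $$ (k, n - 1))"
      using A M[of x] e[of i] F unfolding carrier_UpmT
      by (auto simp: scalar_prod_def atLeast0LessThan intro!: sum.cong)
    also have "\<dots> = (\<Sum>k<n. (if k = e i then
          (if i = 0 then \<chi> x else if length F \<le> i then 1 else 0) * A $$ (e i, n - 1) else 0) +
        (if k = e (Suc i) then (if i < length F \<and> F ! i = x then A $$ (e (Suc i), n - 1) else 0) else 0))"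
      using F e[of i] by (intro sum.cong refl) (auto simp: factor_mat_def e_def)
    also have "\<dots> = (if i = 0 then \<chi> x else if length F \<le> i then 1 else 0) * A $$ (e i, n - 1) +
      (if i < length F \<and> F ! i = x then A $$ (e (Suc i), n - 1) else 0)"
      using e[of i] e[of "Suc i"] by (simp add: sum.distrib)
    finally show ?thesis .
  qed
  have pos: "mat_val n ?M (map Var u) $$ (e i, n - 1) =
      (if take (length F - i) u = drop i F then 1 else 0)" if "1 \<le> i" "i \<le> length F" for i u
    using that
  proof (induction u arbitrary: i)
    case Nil
    then show ?case using F by (auto simp: e_def)
  next
    case (Cons x u)
    show ?case
    proof (cases "i = length F")
      case True
      then show ?thesis
        using Cons F step[OF mat_val_carrier_mat[of ?M n "map Var u", OF M], of x i] by (cases "F = []") auto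
    next
      case False
      then have i: "i < length F" using Cons.prems by simp
      then have "drop i F = F ! i # drop (Suc i) F" "length F - i = Suc (length F - Suc i)"
        by (auto simp: Cons_nth_drop_Suc)
      then show ?thesis
        using Cons.IH[of "Suc i"] Cons.prems i F step[OF mat_val_carrier_mat[of ?M n "map Var u", OF M], of x i]
        by auto
    qed
  qed
  show ?thesis
  proof (induction u)
    case Nil
    then show ?case using F by (simp add: occ_def)
  next
    case (Cons x u)
    have F0: "take (length F) (x # u) = F \<longleftrightarrow> F ! 0 = x \<and> take (length F - 1) u = drop 1 F"
      using F by (cases F) auto
    have "mat_val n ?M (map Var (x # u)) $$ (0, n - 1) =
        \<chi> x * mat_val n ?M (map Var u) $$ (0, n - 1) +
        (if F ! 0 = x then mat_val n ?M (map Var u) $$ (e 1, n - 1) else 0)"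
      using step[OF mat_val_carrier_mat[of ?M n "map Var u", OF M], of x 0] F e0 by auto
    also have "\<dots> = \<chi> x * (\<Sum>p\<in>occ F u. prod_list (map \<chi> (take p u))) +
        (if take (length F) (x # u) = F then 1 else 0)"
      using Cons pos[of 1 u] F F0 by simp
    also have "\<dots> = (\<Sum>p\<in>occ F (x # u). prod_list (map \<chi> (take p (x # u))))"
      unfolding sum_occ_Cons by (simp add: sum_distrib_left)
    finally show ?case .
  qed
qed

lemma prod_list_sign_change:
  fixes \<chi> :: "'b \<Rightarrow> 'a::comm_ring_1"
  shows "prod_list (map (\<chi>(b := - \<chi> b)) w) = (-1) ^ count_list w b * prod_list (map \<chi> w)"
  by (induction w) (auto simp: mult_ac)

text \<open>Fourier inversion on the group of parity vectors, one letter at a time.\<close>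

lemma parity_count:
  fixes P Q :: "nat set" and v w :: "nat \<Rightarrow> 'b list"
  assumes two: "(2 :: 'a::field) \<noteq> 0" and B: "finite B" and fin: "finite P" "finite Q"
    and eq: "\<And>\<chi> :: 'b \<Rightarrow> 'a. (\<And>x. \<chi> x \<in> {1, -1}) \<Longrightarrow>
      (\<Sum>p\<in>P. prod_list (map \<chi> (v p))) = (\<Sum>p\<in>Q. prod_list (map \<chi> (w p)))"
  shows "of_nat (card {p \<in> P. \<forall>b\<in>B. odd (count_list (v p) b) = g b}) =
    (of_nat (card {p \<in> Q. \<forall>b\<in>B. odd (count_list (w p) b) = g b}) :: 'a)"
proof -
  define S where "S P v B \<chi> = (\<Sum>p\<in>{p \<in> P. \<forall>b\<in>B. odd (count_list (v p) b) = g b}. prod_list (map \<chi> (v p)))"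
    for P :: "nat set" and v :: "nat \<Rightarrow> 'b list" and B and \<chi> :: "'b \<Rightarrow> 'a"
  \<comment> \<open>Adding or subtracting the sum with the sign of \<open>b\<close> switched cancels
    the terms with the wrong parity of \<open>b\<close> and doubles the others.\<close>
  have step: "2 * S P v (insert b B) \<chi> = S P v B \<chi> + (if g b then -1 else 1) * S P v B (\<chi>(b := - \<chi> b))"
    if P: "finite P" for P v b B \<chi>
  proof -
    let ?A = "{p \<in> P. \<forall>b\<in>B. odd (count_list (v p) b) = g b}"
    have "S P v B \<chi> + (if g b then -1 else 1) * S P v B (\<chi>(b := - \<chi> b)) =
        (\<Sum>p\<in>?A. prod_list (map \<chi> (v p)) + (if g b then -1 else 1) * ((-1) ^ count_list (v p) b * prod_list (map \<chi> (v p))))"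
      unfolding S_def prod_list_sign_change by (simp add: sum.distrib sum_distrib_left)
    also have "\<dots> = (\<Sum>p\<in>?A. if odd (count_list (v p) b) = g b then 2 * prod_list (map \<chi> (v p)) else 0)"
      by (intro sum.cong refl) auto
    also have "\<dots> = (\<Sum>p\<in>{p\<in>?A. odd (count_list (v p) b) = g b}. 2 * prod_list (map \<chi> (v p)))"
      using P by (intro sum.inter_filter[symmetric]) simp
    also have "{p\<in>?A. odd (count_list (v p) b) = g b} = {p \<in> P. \<forall>b\<in>insert b B. odd (count_list (v p) b) = g b}"
      by auto
    finally show ?thesis
      unfolding S_def by (simp add: sum_distrib_left)
  qed
  have "S P v B \<chi> = S Q w B \<chi>" if "\<And>x. \<chi> x \<in> {1, -1}" for \<chi>
    using B that
  proof (induction B arbitrary: \<chi>)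
    case empty
    then show ?case using eq[of \<chi>] by (simp add: S_def)
  next
    case (insert b B)
    have \<chi>': "(\<chi>(b := - \<chi> b)) x \<in> {1, -1}" for x
      using insert.prems[of b] insert.prems[of x] by (cases "x = b") auto
    then have "2 * S P v (insert b B) \<chi> = 2 * S Q w (insert b B) \<chi>"
      using insert.IH[of \<chi>, OF insert.prems] insert.IH[of "\<chi>(b := - \<chi> b)", OF \<chi>']
      unfolding step[OF fin(1)] step[OF fin(2)] by (simp only:)
    then show ?case using two by simp
  qed
  from this[of "\<lambda>_. 1"] show ?thesis
    by (simp add: S_def prod_list_replicate map_replicate_const)
qed

text \<open>The counts agree as field elements, that is, modulo the characteristic, which is enough
  to tell a single occurrence from none.\<close>

lemma mat_identity_occ:
  fixes u v :: "nat list"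
  assumes id: "mat_identity TYPE('a::field) n (map Var u) (map Var v)" and two: "(2 :: 'a) \<noteq> 0"
    and F: "1 \<le> length F" "length F < n" and B: "finite B"
  shows "of_nat (card {p \<in> occ F u. \<forall>b\<in>B. odd (count_list (take p u) b) = g b}) =
    (of_nat (card {p \<in> occ F v. \<forall>b\<in>B. odd (count_list (take p v) b) = g b}) :: 'a)"
proof (rule parity_count[OF two B finite_occ finite_occ])
  fix \<chi> :: "nat \<Rightarrow> 'a" assume \<chi>: "\<And>x. \<chi> x \<in> {1, -1}"
  have "mat_val n (factor_mat n F \<chi>) (map Var u) = mat_val n (factor_mat n F \<chi>) (map Var v)"
    by (rule id[unfolded mat_identity_def, rule_format]) (rule factor_mat_UpmT[OF F \<chi>])
  then show "(\<Sum>p\<in>occ F u. prod_list (map \<chi> (take p u))) = (\<Sum>p\<in>occ F v. prod_list (map \<chi> (take p v)))"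
    using factor_mat_val[of F n \<chi> u, OF F \<chi>] factor_mat_val[of F n \<chi> v, OF F \<chi>] by simp
qed

section \<open>Recovering a word from its counts\<close>

lemma occD: "p \<in> occ F u \<Longrightarrow> i < length F \<Longrightarrow> p + i < length u \<and> u ! (p + i) = F ! i"
proof -
  assume p: "p \<in> occ F u" "i < length F"
  then have *: "take (length F) (drop p u) = F" "p < length u" by (auto simp: occ_def)
  then have "length F \<le> length u - p"
    by (metis length_drop length_take min.bounded_iff order_refl)
  then show ?thesis
    using p *(2) arg_cong[OF *(1), of "\<lambda>x. x ! i"] by simp
qed

text \<open>In characteristic \<open>0\<close> the counts agree exactly, so a letter behind a prefix
  of given parity vector occurs in one word iff it does in the other. In \<open>u\<close> the parity
  vector determines the position, so \<open>v\<close> is rebuilt letter by letter. Only factors of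
  length 1 are counted, hence \<open>n = 2\<close> suffices.\<close>

lemma isoterm_char_0:
  fixes u v :: "nat list"
  assumes char: "CHAR('a::field) = 0" and n: "2 \<le> n" and u: "no_even_factor u"
    and id: "mat_identity TYPE('a) n (map Var u) (map Var v)"
  shows "v = u"
proof -
  let ?par = "\<lambda>w i b. odd (count_list (take i w) b)"
  define B where "B = set u \<union> set v"
  have "(of_nat 2 :: 'a) \<noteq> 0"
    unfolding of_nat_eq_0_iff_char_dvd char by simp
  then have two: "(2 :: 'a) \<noteq> 0"
    by simp
  have le: "k = l" if "k \<le> l" "(of_nat k :: 'a) = of_nat l" for k l
  proof -
    have "(of_nat (l - k) :: 'a) = 0"
      using that by (simp add: of_nat_diff)
    then show ?thesis
      unfolding of_nat_eq_0_iff_char_dvd char using that by simp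
  qed
  have inj: "(of_nat k :: 'a) = of_nat l \<longleftrightarrow> k = l" for k l
    using le[of k l] le[of l k] by (metis nle_le)
  have card: "card {p \<in> occ [y] u. \<forall>b\<in>B. ?par u p b = g b} = card {p \<in> occ [y] v. \<forall>b\<in>B. ?par v p b = g b}"
    for y g
    using mat_identity_occ[OF id two, of "[y]" B g] n unfolding inj by (simp add: B_def)
  have transfer: "\<exists>j. j < length s \<and> s ! j = t ! i \<and> (\<forall>b. ?par s j b = ?par t i b)"
    if st: "(s, t) \<in> {(u, v), (v, u)}" and i: "i < length t" for s t i
  proof -
    have "i \<in> {p \<in> occ [t ! i] t. \<forall>b\<in>B. ?par t p b = ?par t i b}"
      using i by (auto simp: occ_def take_Suc_conv_app_nth take_drop)
    moreover have "finite {p \<in> occ [t ! i] t. \<forall>b\<in>B. ?par t p b = ?par t i b}"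
      by simp
    ultimately have "card {p \<in> occ [t ! i] t. \<forall>b\<in>B. ?par t p b = ?par t i b} \<noteq> 0"
      unfolding card_eq_0_iff by blast
    moreover have "card {p \<in> occ [t ! i] t. \<forall>b\<in>B. ?par t p b = ?par t i b} =
        card {p \<in> occ [t ! i] s. \<forall>b\<in>B. ?par s p b = ?par t i b}"
      using st card[of "t ! i" "?par t i"] by auto
    ultimately have "{p \<in> occ [t ! i] s. \<forall>b\<in>B. ?par s p b = ?par t i b} \<noteq> {}"
      by (metis card.empty)
    then obtain j where j: "j \<in> occ [t ! i] s" "\<forall>b\<in>B. ?par s j b = ?par t i b"
      by blast
    have "?par s j b = ?par t i b" if "b \<notin> B" for b
    proof -
      have "b \<notin> set (take j s)" "b \<notin> set (take i t)"
        using that st by (auto simp: B_def dest: in_set_takeD)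
      then show ?thesis
        by (simp add: count_notin)
    qed
    then show ?thesis
      using j occD[of j "[t ! i]" s 0] by auto
  qed
  have prefix: "i \<le> length u \<and> take i v = take i u" if "i \<le> length v" for i
    using that
  proof (induction i)
    case (Suc i)
    then obtain j where j: "j < length u" "u ! j = v ! i" "\<forall>b. ?par u j b = ?par v i b"
      using transfer[of u v i] by auto
    then have "j = i"
      using no_even_factor_take[OF u, of j i] Suc by simp
    then show ?case
      using j Suc by (simp add: take_Suc_conv_app_nth)
  qed simp
  have "\<not> length v < length u"
  proof
    assume less: "length v < length u"
    then obtain j where j: "j < length v" "\<forall>b. ?par v j b = ?par u (length v) b"
      using transfer[of v u "length v"] by auto
    then have "j = length v"
      using no_even_factor_take[OF u, of j "length v"] prefix[of j] less by auto
    then show False using j by simp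
  qed
  then show ?thesis
    using prefix[of "length v"] by simp
qed

text \<open>Letters that survive the deletion are located by parities, and deleted letters are
  isolated. With the ends marked, every further letter ends a factor of length at most 3 that starts
  at an earlier surviving letter, and such a factor has the same place in both words; length 3
  requires \<open>n \<ge> 4\<close>.\<close>

lemma fill_deleted:
  fixes u v :: "nat list"
  assumes two: "(2 :: 'a::field) \<noteq> 0" and n: "4 \<le> n"
    and con: "successively (\<lambda>x y. \<rho> x = \<kappa> y) u" and D: "\<And>x. x \<in> D \<Longrightarrow> \<not> \<kappa> x \<and> \<rho> x"
    and filter: "filter (\<lambda>x. x \<notin> D) u = filter (\<lambda>x. x \<notin> D) v"
    and nev: "no_even_factor (filter (\<lambda>x. x \<notin> D) u)"
    and id: "mat_identity TYPE('a) n (map Var u) (map Var v)"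
  shows "u = v"
proof -
  \<comment> \<open>\<open>D\<close> may contain all variables; its part that occurs leaves room for
    fresh end markers \<open>s\<close> and \<open>t\<close> outside it.\<close>
  define E where "E = D \<inter> (set u \<union> set v)"
  define B where "B = (set u \<union> set v) - D"
  have finE: "finite (E \<union> (set u \<union> set v))" by (simp add: E_def)
  obtain s where s: "s \<notin> E \<union> (set u \<union> set v)"
    using ex_new_if_finite[OF infinite_UNIV_nat finE] ..
  have "finite (insert s (E \<union> (set u \<union> set v)))" using finE by simp
  from ex_new_if_finite[OF infinite_UNIV_nat this]
  obtain t where t: "t \<notin> insert s (E \<union> (set u \<union> set v))" ..
  define U where "U = s # u @ [t]"
  define V where "V = s # v @ [t]"
  let ?B = "insert s (insert t B)"
  let ?par = "\<lambda>w i b. odd (count_list (take i w) b)"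
  have filt: "filter (\<lambda>x. x \<notin> E) w = filter (\<lambda>x. x \<notin> D) w" if "set w \<subseteq> set u \<union> set v" for w
    using that by (intro filter_cong) (auto simp: E_def)
  have fU: "filter (\<lambda>x. x \<notin> E) U = s # filter (\<lambda>x. x \<notin> D) u @ [t]"
    using s t filt[of u] by (simp add: U_def)
  have fV: "filter (\<lambda>x. x \<notin> E) V = filter (\<lambda>x. x \<notin> E) U"
    using s t filt[of u] filt[of v] filter by (simp add: U_def V_def)
  have nevU: "no_even_factor (filter (\<lambda>x. x \<notin> E) U)"
    unfolding fU using s t by (intro no_even_factor_Cons no_even_factor_snoc nev) auto
  have idUV: "mat_identity TYPE('a) n (map Var U) (map Var V)"
    using mat_identity_wrap[OF id, of "[Var s]" "[Var t]"] by (simp add: U_def V_def)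
  have mem: "x \<in> ?B" if "x \<in> set U \<union> set V" "x \<notin> E" for x
    using that by (auto simp: B_def E_def U_def V_def)
  text \<open>A letter that is not deleted is located by the parities of the prefix before it.\<close>
  have unique: "i = j"
    if W: "filter (\<lambda>x. x \<notin> E) W = filter (\<lambda>x. x \<notin> E) U" "set W \<subseteq> set U \<union> set V"
      and i: "i < length W" "W ! i \<notin> E" and j: "j < length W" "W ! j \<notin> E"
      and par: "\<forall>b\<in>?B. ?par W i b = ?par W j b" for W i j
  proof -
    have *: "\<not> i < j" if ij: "i < j" "j < length W" "W ! i \<notin> E" and par: "\<forall>b\<in>?B. ?par W i b = ?par W j b" for i j
    proof -
      define e where "e = take (j - i) (drop i W)"
      have tj: "take j W = take i W @ e"
        using ij by (metis e_def le_add_diff_inverse less_imp_le take_add)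
      have "filter (\<lambda>x. x \<notin> E) e = []"
      proof (rule no_even_factorD[OF nevU])
        show "filter (\<lambda>x. x \<notin> E) U =
            filter (\<lambda>x. x \<notin> E) (take i W) @ filter (\<lambda>x. x \<notin> E) e @ filter (\<lambda>x. x \<notin> E) (drop j W)"
          unfolding W(1)[symmetric] by (metis append.assoc append_take_drop_id filter_append tj)
        show "even (count_list (filter (\<lambda>x. x \<notin> E) e) x)" for x
        proof (cases "x \<in> set e \<and> x \<notin> E")
          case True
          then have "x \<in> ?B"
            using mem W(2) by (auto simp: e_def dest!: in_set_takeD in_set_dropD)
          then show ?thesis
            using par tj by (auto simp: count_list_filter)
        next
          case False
          then show ?thesis by (auto simp: count_list_filter count_list_0_iff)
        qed
      qed
      moreover have "W ! i \<in> set e"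
        using ij by (auto simp: e_def in_set_conv_nth intro!: exI[of _ 0])
      ultimately show ?thesis
        using ij by (auto simp: filter_empty_conv)
    qed
    show ?thesis
      using *[of i j] *[of j i] i j par by (metis linorder_neqE_nat)
  qed
  \<comment> \<open>No other occurrence of \<open>F\<close> in \<open>U\<close> shares the parity
    vector of the surviving letter at \<open>p\<close>, so the count is 1 and \<open>V\<close> has
    such an occurrence too; in \<open>V\<close> only position \<open>p\<close> fits.\<close>
  have transfer: "take (length F) (drop p V) = F"
    if F: "p + length F \<le> length U" "take (length F) (drop p U) = F" "1 \<le> length F" "length F < n"
      and p: "take (Suc p) V = take (Suc p) U" "U ! p \<notin> E" "p < length V" for F p
  proof -
    have pU: "p < length U" using F by simp
    have lF: "0 < length F" using F(3) by linarith
    have Vp: "V ! p = U ! p"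
      using p(1,3) pU by (metis lessI nth_take)
    have pre: "take p V = take p U"
      using p(1) by (metis lessI less_imp_le min.absorb1 take_take)
    have "F ! 0 = take (length F) (drop p U) ! 0"
      by (simp only: F(2))
    also have "\<dots> = U ! p"
      using lF pU by (subst nth_take) auto
    finally have F0: "F ! 0 = U ! p" .
    have "{q \<in> occ F U. \<forall>b\<in>?B. ?par U q b = ?par U p b} = {p}"
    proof (intro equalityI subsetI)
      fix q assume q: "q \<in> {q \<in> occ F U. \<forall>b\<in>?B. ?par U q b = ?par U p b}"
      then have "q \<in> occ F U" and par: "\<forall>b\<in>?B. ?par U q b = ?par U p b"
        by simp_all
      then have "q < length U" "U ! q = U ! p"
        using occD[of q F U 0] lF F0 by simp_all
      then show "q \<in> {p}"
        using unique[OF refl _ _ _ pU p(2) par] p(2) by simp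
    qed (use F pU in \<open>auto simp: occ_def\<close>)
    then have "(of_nat (card {q \<in> occ F V. \<forall>b\<in>?B. ?par V q b = ?par U p b}) :: 'a) = 1"
      using mat_identity_occ[OF idUV two F(3,4), of ?B "?par U p"] by (simp add: B_def)
    then have "{q \<in> occ F V. \<forall>b\<in>?B. ?par V q b = ?par U p b} \<noteq> {}"
      by (metis card.empty of_nat_0 zero_neq_one)
    then obtain q where q: "q \<in> occ F V" "\<forall>b\<in>?B. ?par V q b = ?par U p b"
      by blast
    have "q < length V" "V ! q = U ! p"
      using occD[OF q(1), of 0] lF F0 by simp_all
    then have "q = p"
      using unique[OF fV, of q p] q(2) p(2,3) Vp pre by simp
    then show ?thesis
      using q(1) by (simp add: occ_def)
  qed
  \<comment> \<open>The markers survive, so two adjacent deleted letters would be adjacent in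
    \<open>u\<close>, against their labels.\<close>
  have conE: "\<not> (U ! i \<in> E \<and> U ! Suc i \<in> E)" if i: "Suc i < length U" for i
  proof
    assume iE: "U ! i \<in> E \<and> U ! Suc i \<in> E"
    then have "i \<noteq> 0"
      using s by (cases i) (auto simp: U_def)
    moreover have "Suc i \<noteq> Suc (length u)"
      using iE t by (auto simp: U_def)
    ultimately obtain k where k: "i = Suc k" "Suc k < length u"
      using i by (cases i) (auto simp: U_def)
    then have "u ! k \<in> D" "u ! Suc k \<in> D"
      using iE by (auto simp: U_def nth_append E_def)
    moreover have "\<rho> (u ! k) = \<kappa> (u ! Suc k)"
      using con k by (simp add: successively_conv_nth)
    ultimately show False
      using D by blast
  qed
  have U0: "U ! 0 \<notin> E" using s by (simp add: U_def)
  \<comment> \<open>To settle the last letter of the prefix of length \<open>p\<close>, start at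
    \<open>p - 2\<close>, or at \<open>p - 3\<close> if the letter at \<open>p - 2\<close> is
    deleted.\<close>
  have main: "p \<le> length V \<and> take p V = take p U" if "p \<le> length U" for p
    using that
  proof (induction p rule: less_induct)
    case (less p)
    have ext: "p \<le> length V \<and> take p V = take p U"
      if q: "q < p" "p - q < n" "1 \<le> p - q" "U ! q \<notin> E" "take (Suc q) V = take (Suc q) U" "q < length V" for q
    proof -
      have "take (p - q) (drop q V) = take (p - q) (drop q U)"
        using transfer[of q "take (p - q) (drop q U)"] q less.prems by simp
      then have "take (p - q) (drop q V) = take (p - q) (drop q U)" "take q V = take q U"
        using q(5) by (simp, metis lessI less_imp_le min.absorb1 take_take)
      then have tp: "take p V = take p U"
        using q(1) by (metis le_add_diff_inverse less_imp_le take_add)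
      then have "min (length V) p = p" using less.prems by (metis length_take min.absorb2)
      then show ?thesis using tp by simp
    qed
    consider "p = 0" | "p = 1" | "2 \<le> p" "U ! (p - 2) \<notin> E" | "2 \<le> p" "U ! (p - 2) \<in> E"
      by linarith
    then show ?case
    proof cases
      case 2
      then show ?thesis by (simp add: U_def V_def)
    next
      case 3
      have "p - 1 \<le> length V \<and> take (p - 1) V = take (p - 1) U"
        using less.IH[of "p - 1"] less.prems 3 by simp
      moreover have "Suc (p - 2) = p - 1" using 3 by simp
      ultimately show ?thesis
        using ext[of "p - 2"] 3 n by simp
    next
      case 4
      then have "p \<noteq> 2" using U0 by auto
      then have p3: "3 \<le> p" using 4 by simp
      then have "Suc (p - 3) = p - 2" by simp
      moreover have "U ! (p - 3) \<notin> E"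
        using conE[of "p - 3"] 4 p3 less.prems \<open>Suc (p - 3) = p - 2\<close> by auto
      moreover have "p - 2 \<le> length V \<and> take (p - 2) V = take (p - 2) U"
        using less.IH[of "p - 2"] less.prems 4 by simp
      ultimately show ?thesis
        using ext[of "p - 3"] p3 n by simp
    qed simp
  qed
  have len: "length U \<le> length V" "take (length U) V = U"
    using main[of "length U"] by auto
  \<comment> \<open>The right marker does not occur in \<open>v\<close>, so finding it at this place
    shows that \<open>v\<close> is not longer than \<open>u\<close>.\<close>
  have "V ! (length u + 1) = t"
    using len by (metis U_def append_Cons lessI length_Cons length_append_singleton nth_append_length nth_take Suc_eq_plus1)
  then have "length u + 1 = length v + 1"
  proof -
    assume Vt: "V ! (length u + 1) = t"
    have "\<not> length u < length v"
    proof
      assume "length u < length v"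
      then have "V ! (length u + 1) \<in> set v"
        by (simp add: V_def nth_append)
      then show False using Vt t by simp
    qed
    then show ?thesis
      using len(1) by (simp add: U_def V_def)
  qed
  then have "length V \<le> length U"
    by (simp add: U_def V_def)
  then have "U = V"
    using len(2) by (metis take_all)
  then show ?thesis
    by (simp add: U_def V_def)
qed

lemma filter_map_Var: "filter (\<lambda>l. letter_var l \<notin> D) (map Var w) = map Var (filter (\<lambda>x. x \<notin> D) w)"
  by (induction w) auto

text \<open>Deletion preserves identities, so by induction the two words agree after it, and
  \<open>fill_deleted\<close> puts the deleted letters back.\<close>

lemma reducible_isoterm:
  fixes u v :: "nat list"
  assumes "reducible u" and two: "(2 :: 'a::field) \<noteq> 0" and n: "4 \<le> n"
    and id: "mat_identity TYPE('a) n (map Var u) (map Var v)"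
  shows "u = v"
  using assms(1) id
proof (induction arbitrary: v)
  case reducible_Nil
  \<comment> \<open>Already the empty word needs an argument: with all variables deleted,
    \<open>fill_deleted\<close> shows that \<open>v\<close> is empty too.\<close>
  have "no_even_factor (filter (\<lambda>x. x \<notin> UNIV) ([] :: nat list))"
    by (simp add: no_even_factor_def)
  then show ?case
    using fill_deleted[OF two n, where u = "[]" and v = v and \<rho> = "\<lambda>_. True" and \<kappa> = "\<lambda>_. False" and D = UNIV]
      reducible_Nil by simp
next
  case (reducible_step \<rho> l u D)
  show ?case
  proof (rule fill_deleted[OF two n reducible_step.hyps(1,2)])
    show "filter (\<lambda>x. x \<notin> D) u = filter (\<lambda>x. x \<notin> D) v"
      using reducible_step.IH mat_identity_delete[OF reducible_step.prems, of D]
      by (simp add: filter_map_Var)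
    show "no_even_factor (filter (\<lambda>x. x \<notin> D) u)"
      by (rule reducible_no_even_factor[OF reducible_step.hyps(3)])
    show "mat_identity TYPE('a) n (map Var u) (map Var v)"
      by (rule reducible_step.prems)
  qed
qed

subsection \<open>Local finiteness\<close>

text \<open>The coefficient, in the \<open>(i, _)\<close> entry of the value of a word, of the monomial given by a path:
  a step \<open>(l, k)\<close> of a path stands for an off-diagonal entry in column \<open>k\<close> of the matrix of the
  letter \<open>l\<close>. It depends only on the diagonal entries \<open>d l i\<close>.\<close>

fun coeff_path :: "(letter \<Rightarrow> nat \<Rightarrow> 'a::comm_ring_1) \<Rightarrow> nat \<Rightarrow> (letter \<times> nat) list \<Rightarrow> letter list \<Rightarrow> 'a" where
  "coeff_path d i [] [] = 1"
| "coeff_path d i (_ # _) [] = 0"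
| "coeff_path d i [] (l # w) = d l i * coeff_path d i [] w"
| "coeff_path d i ((l', k) # \<mu>) (l # w) =
    d l i * coeff_path d i ((l', k) # \<mu>) w + (if l = l' then coeff_path d k \<mu> w else 0)"

text \<open>Zero unless the columns increase strictly from \<open>i\<close>, so for
  \<open>j < n\<close> only paths with fewer than \<open>n\<close> steps contribute.\<close>

fun path_prod :: "(letter \<Rightarrow> 'a::comm_ring_1 mat) \<Rightarrow> nat \<Rightarrow> nat \<Rightarrow> (letter \<times> nat) list \<Rightarrow> 'a" where
  "path_prod N j i [] = (if i = j then 1 else 0)"
| "path_prod N j i ((l, k) # \<mu>) = (if i < k then N l $$ (i, k) * path_prod N j k \<mu> else 0)"

definition paths :: "letter set \<Rightarrow> nat \<Rightarrow> nat \<Rightarrow> (letter \<times> nat) list set" where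
  "paths A n m = {\<mu>. set \<mu> \<subseteq> A \<times> {..<n} \<and> length \<mu> \<le> m}"

lemma finite_paths: "finite A \<Longrightarrow> finite (paths A n m)"
  unfolding paths_def by (rule finite_lists_length_le) simp

lemma sum_paths_Suc:
  assumes A: "finite A"
  shows "sum h (paths A n (Suc m)) = h [] + (\<Sum>l\<in>A. \<Sum>k<n. \<Sum>\<mu>\<in>paths A n m. h ((l, k) # \<mu>))"
proof -
  have eq: "paths A n (Suc m) = insert [] ((\<lambda>((l, k), \<mu>). (l, k) # \<mu>) ` ((A \<times> {..<n}) \<times> paths A n m))"
  proof (intro equalityI subsetI)
    fix \<mu> assume "\<mu> \<in> paths A n (Suc m)"
    then show "\<mu> \<in> insert [] ((\<lambda>((l, k), \<mu>). (l, k) # \<mu>) ` ((A \<times> {..<n}) \<times> paths A n m))"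
      by (cases \<mu>) (auto simp: paths_def intro!: image_eqI[of _ _ "((a, b), c)" for a b c])
  qed (auto simp: paths_def)
  have "sum h (paths A n (Suc m)) =
      h [] + sum h ((\<lambda>((l, k), \<mu>). (l, k) # \<mu>) ` ((A \<times> {..<n}) \<times> paths A n m))"
    unfolding eq using A finite_paths[OF A, of n m] by (subst sum.insert) auto
  also have "sum h ((\<lambda>((l, k), \<mu>). (l, k) # \<mu>) ` ((A \<times> {..<n}) \<times> paths A n m)) =
      (\<Sum>((l, k), \<mu>)\<in>(A \<times> {..<n}) \<times> paths A n m. h ((l, k) # \<mu>))"
    by (subst sum.reindex) (auto simp: inj_on_def intro!: sum.cong)
  also have "\<dots> = (\<Sum>z\<in>A \<times> {..<n}. \<Sum>\<mu>\<in>paths A n m. h ((fst z, snd z) # \<mu>))"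
    by (subst sum.cartesian_product) (simp add: split_def)
  also have "\<dots> = (\<Sum>l\<in>A. \<Sum>k<n. \<Sum>\<mu>\<in>paths A n m. h ((l, k) # \<mu>))"
    by (subst sum.cartesian_product) (simp add: split_def)
  finally show ?thesis .
qed

text \<open>The entries above the diagonal are treated as indeterminates: the first letter either
  stays on the diagonal or makes the first step of the path. The bound \<open>n \<le> i + m\<close>
  leaves room for every strictly increasing path from \<open>i\<close>.\<close>

lemma mat_val_path_expansion:
  fixes M :: "nat \<Rightarrow> 'a::field mat"
  assumes M: "\<And>x. M x \<in> carrier (UpmT n)" and A: "finite A" and w: "set w \<subseteq> A"
    and i: "i < n" "n \<le> i + m" and j: "j < n"
  shows "mat_val n M w $$ (i, j) =
    (\<Sum>\<mu>\<in>paths A n m. coeff_path (\<lambda>l i. letter_val (UpmT n) M l $$ (i, i)) i \<mu> w *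
      path_prod (letter_val (UpmT n) M) j i \<mu>)"
  using w i
proof (induction w arbitrary: i m)
  case Nil
  then obtain m' where m: "m = Suc m'" by (cases m) auto
  show ?case
    unfolding m sum_paths_Suc[OF A] using Nil j by simp
next
  case (Cons l w)
  then obtain m' where m: "m = Suc m'" by (cases m) auto
  let ?N = "letter_val (UpmT n) M"
  let ?c = "coeff_path (\<lambda>l i. ?N l $$ (i, i))"
  have N: "?N l \<in> carrier_mat n n" "upper_triangular (?N l)"
    using letter_val_UpmT[of M n l] M by (auto simp: carrier_UpmT)
  have R: "mat_val n M w \<in> carrier_mat n n"
    using mat_val_carrier_mat[of M n w] M by blast
  have "mat_val n M (l # w) $$ (i, j) = (\<Sum>k<n. ?N l $$ (i, k) * mat_val n M w $$ (k, j))"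
    using N(1) R Cons.prems j by (auto simp: scalar_prod_def atLeast0LessThan intro!: sum.cong)
  also have "\<dots> = (\<Sum>k<n. (if k = i then ?N l $$ (i, i) * mat_val n M w $$ (i, j) else 0) +
      (if i < k then ?N l $$ (i, k) * mat_val n M w $$ (k, j) else 0))"
    using upper_triangularD[OF N(2)] N(1) Cons.prems by (intro sum.cong refl) (auto simp: linorder_neq_iff)
  also have "\<dots> = ?N l $$ (i, i) * mat_val n M w $$ (i, j) +
      (\<Sum>k<n. if i < k then ?N l $$ (i, k) * mat_val n M w $$ (k, j) else 0)"
    using Cons.prems by (simp add: sum.distrib)
  also have "?N l $$ (i, i) * mat_val n M w $$ (i, j) =
      (\<Sum>\<mu>\<in>paths A n m. ?N l $$ (i, i) * ?c i \<mu> w * path_prod ?N j i \<mu>)"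
    using Cons.IH[of i m] Cons.prems by (simp add: sum_distrib_left mult_ac)
  also have "(\<Sum>k<n. if i < k then ?N l $$ (i, k) * mat_val n M w $$ (k, j) else 0) =
      (\<Sum>k<n. \<Sum>\<mu>\<in>paths A n m'. if i < k then ?c k \<mu> w * (?N l $$ (i, k) * path_prod ?N j k \<mu>) else 0)"
    using Cons.IH[of _ m'] Cons.prems m
    by (intro sum.cong refl) (auto simp: sum_distrib_left mult_ac)
  also have "\<dots> = (\<Sum>k<n. \<Sum>\<mu>\<in>paths A n m'. ?c k \<mu> w * path_prod ?N j i ((l, k) # \<mu>))"
    by (intro sum.cong refl) auto
  also have "\<dots> = (\<Sum>l'\<in>A. if l' = l then \<Sum>k<n. \<Sum>\<mu>\<in>paths A n m'. ?c k \<mu> w * path_prod ?N j i ((l', k) # \<mu>) else 0)"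
    using A Cons.prems by simp
  also have "\<dots> = (\<Sum>l'\<in>A. \<Sum>k<n. \<Sum>\<mu>\<in>paths A n m'.
      (if l = l' then ?c k \<mu> w else 0) * path_prod ?N j i ((l', k) # \<mu>))"
    by (intro sum.cong refl) auto
  finally show ?case
    unfolding m sum_paths_Suc[OF A] by (simp add: sum.distrib distrib_right add_ac del: path_prod.simps(2))
qed

lemma coeff_path_mem:
  assumes "1 \<in> R" "0 \<in> R" "\<And>x y. x \<in> R \<Longrightarrow> y \<in> R \<Longrightarrow> x + y \<in> R" "\<And>x y. x \<in> R \<Longrightarrow> y \<in> R \<Longrightarrow> x * y \<in> R"
    and "\<And>l i. d l i \<in> R"
  shows "coeff_path d i \<mu> w \<in> R"
  using assms(5) by (induction d i \<mu> w rule: coeff_path.induct) (auto simp: assms(1-4))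

lemma coeff_path_cong:
  assumes "\<And>l k. l \<in> set w \<Longrightarrow> k \<in> insert i (snd ` set \<mu>) \<Longrightarrow> d l k = d' l k"
  shows "coeff_path d i \<mu> w = coeff_path d' i \<mu> w"
  using assms by (induction d i \<mu> w rule: coeff_path.induct) auto

lemma finite_range_of_int:
  assumes "CHAR('a::ring_1) > 0"
  shows "finite (range (of_int :: int \<Rightarrow> 'a))"
proof -
  have eq: "of_int a = (of_nat (nat (a mod int CHAR('a))) :: 'a)" for a
  proof -
    have "(of_int a :: 'a) = of_int (a mod int CHAR('a) + int CHAR('a) * (a div int CHAR('a)))"
      by simp
    also have "\<dots> = of_int (a mod int CHAR('a))"
      unfolding of_int_add of_int_mult by simp
    also have "\<dots> = of_nat (nat (a mod int CHAR('a)))"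
      using assms by simp
    finally show ?thesis .
  qed
  have "range (of_int :: int \<Rightarrow> 'a) \<subseteq> of_nat ` {..<CHAR('a)}"
  proof
    fix x :: 'a assume "x \<in> range of_int"
    then obtain a where "x = of_int a" ..
    then have "x = of_nat (nat (a mod int CHAR('a)))"
      using eq[of a] by simp
    moreover have "nat (a mod int CHAR('a)) < CHAR('a)"
      using assms by (simp add: nat_less_iff)
    ultimately show "x \<in> of_nat ` {..<CHAR('a)}"
      by blast
  qed
  then show ?thesis
    using finite_surj by blast
qed

text \<open>A word enters its value only through the path coefficients, which depend on diagonals
  over \<open>{0, 1, -1}\<close> and lie in the finite prime ring. So there are finitely many tables
  of coefficients, although the field may be infinite.\<close>

lemma mat_identity_finite_index:
  assumes char: "CHAR('a::field) > 0" and A: "finite A"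
  shows "\<exists>W. finite W \<and> W \<subseteq> lists A - {[]} \<and>
    (\<forall>w\<in>lists A - {[]}. \<exists>v\<in>W. mat_identity TYPE('a) n v w)"
proof -
  define R where "R = range (of_int :: int \<Rightarrow> 'a)"
  have R: "finite R" "\<And>x y. x \<in> R \<Longrightarrow> y \<in> R \<Longrightarrow> x + y \<in> R" "\<And>x y. x \<in> R \<Longrightarrow> y \<in> R \<Longrightarrow> x * y \<in> R"
    unfolding R_def using finite_range_of_int[OF char] by (auto simp flip: of_int_add of_int_mult)
  have R01: "0 \<in> R" "1 \<in> R" "-1 \<in> R"
    unfolding R_def by (metis rangeI of_int_0, metis rangeI of_int_1, metis rangeI of_int_minus of_int_1)
  define \<D> where "\<D> = (A \<times> {..<n}) \<rightarrow>\<^sub>E {0, 1, -1 :: 'a}"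
  define I where "I = \<D> \<times> {..<n} \<times> paths A n n"
  define ext :: "(letter \<times> nat \<Rightarrow> 'a) \<Rightarrow> letter \<Rightarrow> nat \<Rightarrow> 'a"
    where "ext d l i = (if l \<in> A \<and> i < n then d (l, i) else 0)" for d l i
  define F where "F w = (\<lambda>(d, i, \<mu>)\<in>I. coeff_path (ext d) i \<mu> w)" for w
  have finI: "finite I"
    unfolding I_def \<D>_def using A finite_paths[OF A] by (auto intro!: finite_PiE)
  have "F w \<in> I \<rightarrow>\<^sub>E R" for w
  proof -
    have "coeff_path (ext d) i \<mu> w \<in> R" if "d \<in> \<D>" for d i \<mu>
    proof (rule coeff_path_mem[OF R01(2,1) R(2,3)])
      show "ext d l i \<in> R" for l i
      proof (cases "l \<in> A \<and> i < n")
        case True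
        then have "d (l, i) \<in> {0, 1, -1}"
          using PiE_mem[OF that[unfolded \<D>_def], of "(l, i)"] by simp
        then have "d (l, i) = 0 \<or> d (l, i) = 1 \<or> d (l, i) = -1"
          by simp
        then show ?thesis
          using R01 True by (elim disjE) (simp_all add: ext_def)
      qed (use R01(1) in \<open>auto simp: ext_def\<close>)
    qed
    then show ?thesis
      unfolding F_def I_def by auto
  qed
  then have finF: "finite (F ` (lists A - {[]}))"
    using finite_PiE[OF finI, of "\<lambda>_. R"] R(1) by (auto intro: finite_subset)
  have id: "mat_identity TYPE('a) n v w" if vw: "v \<in> lists A" "w \<in> lists A" "F v = F w" for v w
    unfolding mat_identity_def
  proof (intro allI impI)
    fix M :: "nat \<Rightarrow> 'a mat" assume M: "\<forall>x. M x \<in> carrier (UpmT n)"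
    let ?N = "letter_val (UpmT n) M"
    define d where "d = (\<lambda>(l, i)\<in>A \<times> {..<n}. ?N l $$ (i, i))"
    have d: "d \<in> \<D>"
      using letter_val_UpmT[of M n] M by (auto simp: \<D>_def d_def carrier_UpmT)
    have coeff: "coeff_path (\<lambda>l i. ?N l $$ (i, i)) i \<mu> u = F u (d, i, \<mu>)"
      if "u \<in> lists A" "i < n" "\<mu> \<in> paths A n n" for u i \<mu>
    proof -
      have "coeff_path (\<lambda>l i. ?N l $$ (i, i)) i \<mu> u = coeff_path (ext d) i \<mu> u"
        using that by (intro coeff_path_cong) (auto simp: ext_def d_def paths_def)
      then show ?thesis
        using that d by (simp add: F_def I_def)
    qed
    show "mat_val n M v = mat_val n M w"
    proof (rule eq_matI)
      have C: "mat_val n M u \<in> carrier_mat n n" for u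
        using mat_val_carrier_mat[of M n u] M by blast
      show "dim_row (mat_val n M v) = dim_row (mat_val n M w)"
        "dim_col (mat_val n M v) = dim_col (mat_val n M w)"
        using C[of v] C[of w] by auto
      fix i j assume "i < dim_row (mat_val n M w)" "j < dim_col (mat_val n M w)"
      then have ij: "i < n" "j < n" using C[of w] by auto
      have "mat_val n M u $$ (i, j) = (\<Sum>\<mu>\<in>paths A n n. F u (d, i, \<mu>) * path_prod ?N j i \<mu>)"
        if "u \<in> lists A" for u
      proof -
        have "mat_val n M u $$ (i, j) =
            (\<Sum>\<mu>\<in>paths A n n. coeff_path (\<lambda>l i. ?N l $$ (i, i)) i \<mu> u * path_prod ?N j i \<mu>)"
          using that ij M by (intro mat_val_path_expansion[OF _ A]) auto
        then show ?thesis
          using coeff[OF that ij(1)] by simp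
      qed
      then show "mat_val n M v $$ (i, j) = mat_val n M w $$ (i, j)"
        using vw by simp
    qed
  qed
  from finite_subset_image[OF finF order_refl] obtain W where
    W: "W \<subseteq> lists A - {[]}" "finite W" "F ` (lists A - {[]}) = F ` W"
    by blast
  have "\<exists>v\<in>W. mat_identity TYPE('a) n v w" if w: "w \<in> lists A - {[]}" for w
  proof -
    have "F w \<in> F ` W" using w W(3) by blast
    then obtain v where "v \<in> W" "F v = F w" by (metis imageE)
    then show ?thesis using id[of v w] w W(1) by blast
  qed
  then show ?thesis using W by blast
qed

lemma locally_finite_UpmT:
  assumes char: "CHAR('a::field) > 0"
  shows "locally_finite_variety (variety_generated_by (UpmT n :: 'a mat invsg))"
  unfolding locally_finite_variety_def
proof (intro ballI impI)
  fix T assume T: "T \<in> variety_generated_by (UpmT n :: 'a mat invsg)" and fg: "finitely_generated T"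
  interpret involutory_semigroup T
    using T by (simp add: variety_generated_by_def variety_defined_by_def)
  obtain G where G: "finite G" "G \<subseteq> carrier T" "invsg_generate T G = carrier T"
    using fg unfolding finitely_generated_def by blast
  have "G \<noteq> {}"
  proof
    assume "G = {}"
    moreover have "False" if "x \<in> invsg_generate T {}" for x
      using that by induction auto
    ultimately show False using G(3) carrier_nonempty by blast
  qed
  then obtain g where g: "g \<in> G" by blast
  \<comment> \<open>The carrier consists of naturals, which are also the variables, so each
    generator serves as its own variable.\<close>
  define a where "a x = (if x \<in> G then x else g)" for x
  have a: "a x \<in> carrier T" for x
    using G g by (auto simp: a_def)
  define A where "A = Var ` G \<union> VarStar ` G"
  have A: "finite A" using G by (simp add: A_def)
  have star: "rev (map letter_star w) \<in> lists A - {[]}" if "w \<in> lists A - {[]}" for w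
    using that by (auto simp: A_def lists_eq_set)
  have "x \<in> word_val T a ` (lists A - {[]})" if "x \<in> invsg_generate T G" for x
    using that
  proof induction
    case (gen x)
    then have "x = word_val T a [Var x]" "[Var x] \<in> lists A - {[]}"
      by (auto simp: a_def A_def)
    then show ?case by blast
  next
    case (gen_mul x y)
    then obtain v w where "x = word_val T a v" "v \<in> lists A - {[]}" "y = word_val T a w" "w \<in> lists A - {[]}"
      by blast
    then have "mul T x y = word_val T a (v @ w)" "v @ w \<in> lists A - {[]}"
      using a by (auto simp: word_val_append)
    then show ?case by blast
  next
    case (gen_invol x)
    then obtain v where v: "x = word_val T a v" "v \<in> lists A - {[]}"
      by blast
    then have "invol T x = word_val T a (rev (map letter_star v))"
      using a by (simp add: word_val_star)
    then show ?case using star[OF v(2)] by blast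
  qed
  then have sub: "carrier T \<subseteq> word_val T a ` (lists A - {[]})"
    unfolding G(3)[symmetric] by (rule subsetI)
  from mat_identity_finite_index[OF char A, of n] obtain W where W: "finite W" "W \<subseteq> lists A - {[]}"
      "\<forall>w\<in>lists A - {[]}. \<exists>v\<in>W. mat_identity TYPE('a) n v w"
    by (elim exE conjE)
  have val: "word_val T a w \<in> word_val T a ` W" if w: "w \<in> lists A - {[]}" for w
  proof -
    obtain v where v: "v \<in> W" "mat_identity TYPE('a) n v w"
      using W(3) w by blast
    then have ne: "v \<noteq> []" "w \<noteq> []" using W(2) w by auto
    then have "(v, w) \<in> identities_of (UpmT n :: 'a mat invsg)"
      using v holds_in_UpmT[OF ne, where 'a = 'a]
      by (simp add: identities_of_def identities_def free_invsg_def)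
    then have "holds_in (v, w) T"
      using T by (simp add: variety_generated_by_def variety_defined_by_def)
    then have "word_val T a v = word_val T a w"
      using a ne by (simp add: holds_in_iff)
    then show ?thesis using v by (metis imageI)
  qed
  have "carrier T \<subseteq> word_val T a ` W"
    using sub val by (auto dest!: subsetD)
  then show "finite (carrier T)"
    using W(1) by (meson finite_imageI finite_subset)
qed

subsection \<open>Odd characteristic\<close>

definition iter_rows :: "nat \<Rightarrow> nat \<Rightarrow> (nat \<times> nat) list" where
  "iter_rows r m = (alt_rows r ^^ m) [(0, 0)]"

definition iter_language :: "nat \<Rightarrow> (nat \<times> nat) list set" where
  "iter_language r = {w. w \<noteq> [] \<and> (\<exists>m p s. p @ w @ s = iter_rows r m)}"

lemma factor_language_iter: "factor_language (iter_language r)"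
  unfolding factor_language_def iter_language_def by clarsimp (metis append.assoc)

lemma length_iter_rows: "length (iter_rows r m) = r ^ m"
proof -
  have "length (alt_rows r g) = r * length g" for g
    by (induction g) (auto simp: alt_rows_def alt_row_def)
  then show ?thesis
    unfolding iter_rows_def by (induction m) auto
qed

lemma infinite_iter_language:
  assumes "2 \<le> r"
  shows "infinite (iter_language r)"
proof
  assume "finite (iter_language r)"
  moreover have "range (iter_rows r) \<subseteq> iter_language r"
  proof
    fix w assume "w \<in> range (iter_rows r)"
    then obtain m where m: "w = iter_rows r m" ..
    then have "w \<noteq> []"
      using length_iter_rows[of r m] assms by auto
    then show "w \<in> iter_language r"
      unfolding iter_language_def m by (auto intro!: exI[of _ m] exI[of _ "[]"])
  qed
  moreover have "inj (iter_rows r)"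
  proof (rule injI)
    fix m k assume "iter_rows r m = iter_rows r k"
    then have "r ^ m = r ^ k" by (metis length_iter_rows)
    then show "m = k" using assms by (simp add: power_inject_exp)
  qed
  ultimately show False
    using finite_subset finite_imageD infinite_UNIV_nat by blast
qed

text \<open>A row takes its first components from the pair it encodes and its columns from
  \<open>{..<r}\<close>, so the alphabet is closed under the substitution.\<close>

lemma iter_language_letters:
  assumes "0 < r"
  shows "iter_language r \<subseteq> lists ({..<r} \<times> {..<r})"
proof -
  have "set (alt_rows r g) \<subseteq> {..<r} \<times> {..<r}" if "set g \<subseteq> {..<r} \<times> {..<r}" for g
    using that by (fastforce simp: alt_rows_def alt_row_def)
  then have "set (iter_rows r m) \<subseteq> {..<r} \<times> {..<r}" for m
    unfolding iter_rows_def using assms by (induction m) auto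
  then show ?thesis
    by (fastforce simp: iter_language_def lists_eq_set dest: arg_cong[of _ _ set])
qed

text \<open>Decoding one level embeds the decoded values in the previous iterate. The variables that
  decode to nothing are the short ones; deleting them leaves a word covered by the induction
  hypothesis.\<close>

lemma iter_rows_reducible:
  fixes \<phi> :: "'v \<Rightarrow> (nat \<times> nat) list"
  assumes "pre @ concat (map \<phi> u) @ suf = iter_rows r m"
    and "\<forall>x\<in>set u. \<phi> x \<noteq> []" and "Suc (card (set u)) < r"
  shows "reducible u"
  using assms
proof (induction m arbitrary: pre \<phi> u suf)
  case 0
  have "length u \<le> length (concat (map \<phi> u))"
    using "0.prems"(2)
  proof (induction u)
    case (Cons x u)
    then show ?case
      by (cases "\<phi> x") (auto intro: le_SucI trans_le_add2)
  qed simp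
  also have "\<dots> \<le> 1"
    using arg_cong[OF "0.prems"(1), of length] by (simp add: iter_rows_def)
  finally show ?case
    by (rule reducible_short)
next
  case (Suc m)
  have eq: "pre @ concat (map \<phi> u) @ suf = alt_rows r (iter_rows r m)"
    using Suc.prems(1) by (simp add: iter_rows_def)
  obtain \<phi>' \<alpha> \<beta> pre' suf' where *: "pre' @ concat (map \<phi>' u) @ suf' = iter_rows r m"
      "successively (\<lambda>x y. \<beta> x = (\<alpha> y :: nat)) u"
      "\<forall>x\<in>set u. \<phi>' x = [] \<longrightarrow> \<alpha> x < \<beta> x"
    using desubstitution[OF eq Suc.prems(2) Suc.prems(3)] by (elim exE conjE)
  define D where "D = {x \<in> set u. \<phi>' x = []}"
  have del: "concat (map \<phi>' (filter (\<lambda>x. x \<notin> D) w)) = concat (map \<phi>' w)" if "set w \<subseteq> set u" for w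
    using that by (induction w) (auto simp: D_def)
  have "reducible (filter (\<lambda>x. x \<notin> D) u)"
  proof (rule Suc.IH)
    show "pre' @ concat (map \<phi>' (filter (\<lambda>x. x \<notin> D) u)) @ suf' = iter_rows r m"
      unfolding del[OF order_refl] by (rule *(1))
    show "\<forall>x\<in>set (filter (\<lambda>x. x \<notin> D) u). \<phi>' x \<noteq> []"
      by (auto simp: D_def)
    have "card (set (filter (\<lambda>x. x \<notin> D) u)) \<le> card (set u)"
      by (intro card_mono) auto
    then show "Suc (card (set (filter (\<lambda>x. x \<notin> D) u))) < r"
      using Suc.prems(3) by simp
  qed
  then show ?case
    by (intro reducible_layers[OF *(2), of D]) (auto simp: D_def *(3))
qed

lemma rigid_iter_language:
  assumes two: "(2 :: 'a::field) \<noteq> 0" and n: "4 \<le> n"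
  shows "rigid (UpmT n :: 'a mat invsg) k (iter_language (k + 2))"
  unfolding rigid_def isoterm_def
proof (intro allI impI)
  fix u :: "nat list" and \<phi> :: "nat \<Rightarrow> (nat \<times> nat) list" and v
  assume u: "u \<noteq> []" "card (set u) \<le> k" "\<forall>x\<in>set u. \<phi> x \<noteq> []"
    "concat (map \<phi> u) \<in> iter_language (k + 2)"
    and v: "v \<noteq> []" "holds_in (map Var u, v) (UpmT n :: 'a mat invsg)"
  obtain m p s where "p @ concat (map \<phi> u) @ s = iter_rows (k + 2) m"
    using u(4) by (auto simp: iter_language_def)
  then have "reducible u"
    using u by (intro iter_rows_reducible) auto
  moreover have id: "mat_identity TYPE('a) n (map Var u) v"
    using holds_in_UpmT[of "map Var u" v n, where 'a = 'a] u(1) v by simp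
  moreover obtain v' where "v = map Var v'"
    using mat_identity_unstarred[OF _ id] n by auto
  ultimately show "v = map Var u"
    using reducible_isoterm[OF _ two n] by metis
qed

lemma inherently_nonfinitely_based_UpmT:
  assumes odd: "odd CHAR('a::field)" and n: "4 \<le> n"
  shows "inherently_nonfinitely_based (UpmT n :: 'a mat invsg)"
proof (rule inherently_nonfinitely_basedI[OF involutory_semigroup_UpmT])
  show "locally_finite_variety (variety_generated_by (UpmT n :: 'a mat invsg))"
    using odd by (intro locally_finite_UpmT) (auto intro: Nat.gr0I)
  have "\<not> CHAR('a) dvd 2"
  proof
    assume "CHAR('a) dvd 2"
    then have "CHAR('a) \<le> 2"
      by (rule dvd_imp_le) simp
    then have "CHAR('a) = 1"
      using odd by (cases "CHAR('a) = 2") (auto simp: le_Suc_eq numeral_2_eq_2)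
    then show False
      by simp
  qed
  then have two: "(2 :: 'a) \<noteq> 0"
    by (metis of_nat_eq_0_iff_char_dvd of_nat_numeral)
  show "\<exists>(L :: (nat \<times> nat) list set) A. factor_language L \<and> rigid (UpmT n :: 'a mat invsg) k L \<and>
      finite A \<and> L \<subseteq> lists A \<and> infinite L" for k
    using factor_language_iter rigid_iter_language[OF two n] infinite_iter_language
      iter_language_letters
    by (intro exI[of _ "iter_language (k + 2)"] exI[of _ "{..<k+2} \<times> {..<k+2}"]) auto
qed

subsection \<open>Characteristic zero\<close>

text \<open>Malcev's nilpotency words with markers at both ends; each level brings in three fresh
  letters.\<close>

fun malcev :: "bool \<Rightarrow> nat \<Rightarrow> nat list" where
  "malcev b 0 = [if b then 1 else 0]"
| "malcev b (Suc m) = [3*m+2] @ malcev b m @ [3*m+3] @ malcev (\<not> b) m @ [3*m+4]"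

lemma malcev_letters: "x \<in> set (malcev b m) \<Longrightarrow> x < 3*m+2"
  by (induction m arbitrary: b) fastforce+

lemma length_malcev: "length (malcev b m) = length (malcev c m)"
proof (induction m arbitrary: b c)
  case (Suc m)
  then show ?case
    by (cases b; cases c) simp_all
qed simp

lemma malcev_neq: "malcev False m \<noteq> malcev True m"
  by (induction m) (auto simp: append_eq_append_conv[OF disjI1[OF length_malcev]])

text \<open>An even factor avoids \<open>z\<close>, which occurs once, and so lies on one side of
  it.\<close>

lemma no_even_factor_middle:
  assumes "no_even_factor A" "no_even_factor B" "z \<notin> set A" "z \<notin> set B"
  shows "no_even_factor (A @ z # B)"
  unfolding no_even_factor_def
proof (intro allI impI)
  fix a e b assume eq: "A @ z # B = a @ e @ b" and ev: "\<forall>x. even (count_list e x)"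
  have "count_list (a @ e @ b) z = 1"
    unfolding eq[symmetric] using assms by simp
  then have "count_list e z \<noteq> 1 \<longrightarrow> count_list e z = 0" by simp
  then have ze: "z \<notin> set e"
    using ev[rule_format, of z] by (metis count_list_0_iff odd_one)
  from eq consider us where "A = a @ us" "us @ z # B = e @ b" | us where "a = A @ us" "z # B = us @ e @ b"
    unfolding append_eq_append_conv2 by blast
  then show "e = []"
  proof cases
    case 1
    from 1(2) consider vs where "us = e @ vs" | vs where "us @ vs = e" "z # B = vs @ b"
      unfolding append_eq_append_conv2 by blast
    then show ?thesis
    proof cases
      case (1 vs)
      then show ?thesis
        using no_even_factorD[OF assms(1), of a e vs] \<open>A = a @ us\<close> ev by simp
    next
      case (2 vs)
      then have "vs = []" using ze by (cases vs) auto
      then show ?thesis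
        using no_even_factorD[OF assms(1), of a e "[]"] \<open>A = a @ us\<close> ev 2 by simp
    qed
  next
    case 2
    show ?thesis
    proof (cases us)
      case Nil
      then show ?thesis using 2 ze by (cases e) auto
    next
      case (Cons y us')
      then show ?thesis
        using no_even_factorD[OF assms(2), of us' e b] 2 ev by simp
    qed
  qed
qed

lemma no_even_factor_malcev: "no_even_factor (malcev b m)"
proof (induction m arbitrary: b)
  case 0
  have "no_even_factor ([] :: nat list)" by (simp add: no_even_factor_def)
  then show ?case using no_even_factor_Cons[of "[]"] by (cases b) simp_all
next
  case (Suc m)
  have fresh: "x \<notin> set (malcev b m)" if "3*m+2 \<le> x" for x b
    using malcev_letters[of x b m] that by auto
  have "no_even_factor (malcev b m @ (3*m+3) # malcev (\<not> b) m)"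
    by (intro no_even_factor_middle Suc fresh) auto
  then have "no_even_factor ((3*m+2) # (malcev b m @ (3*m+3) # malcev (\<not> b) m))"
    by (rule no_even_factor_Cons) (use fresh[of "3*m+2"] in auto)
  then have "no_even_factor (((3*m+2) # (malcev b m @ (3*m+3) # malcev (\<not> b) m)) @ [3*m+4])"
    by (rule no_even_factor_snoc) (use fresh[of "3*m+4"] in auto)
  then show ?case by simp
qed

text \<open>The words \<open>malcev True m\<close> and \<open>malcev False m\<close> are equal for triangular matrices with a common
  diagonal: each recursion step moves the difference one superdiagonal further away.\<close>

lemma sandwich_entry:
  fixes A B P Q :: "'a::field mat"
  assumes C: "A \<in> carrier_mat n n" "B \<in> carrier_mat n n" "P \<in> carrier_mat n n" "Q \<in> carrier_mat n n"
    and ut: "upper_triangular A" "upper_triangular B"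
    and eq: "\<And>k l. \<lbrakk>k < n; l < n; l < k + m\<rbrakk> \<Longrightarrow> P $$ (k, l) = Q $$ (k, l)"
    and ij: "i < n" "j < n" "j \<le> i + m"
  shows "(A * (P * B)) $$ (i, j) - (A * (Q * B)) $$ (i, j) = A $$ (i, i) * (P $$ (i, j) - Q $$ (i, j)) * B $$ (j, j)"
proof -
  have entry: "(A * (R * B)) $$ (i, j) = (\<Sum>k<n. \<Sum>l<n. A $$ (i, k) * R $$ (k, l) * B $$ (l, j))"
    if R: "R \<in> carrier_mat n n" for R
  proof -
    have "(A * (R * B)) $$ (i, j) = (\<Sum>k<n. A $$ (i, k) * (R * B) $$ (k, j))"
      using C R ij by (auto simp: scalar_prod_def atLeast0LessThan intro!: sum.cong)
    also have "\<dots> = (\<Sum>k<n. A $$ (i, k) * (\<Sum>l<n. R $$ (k, l) * B $$ (l, j)))"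
      using C R ij by (intro sum.cong refl) (auto simp: scalar_prod_def atLeast0LessThan intro!: sum.cong)
    finally show ?thesis by (simp add: sum_distrib_left mult.assoc)
  qed
  have "(A * (P * B)) $$ (i, j) - (A * (Q * B)) $$ (i, j) =
      (\<Sum>k<n. \<Sum>l<n. A $$ (i, k) * (P $$ (k, l) - Q $$ (k, l)) * B $$ (l, j))"
    unfolding entry[OF C(3)] entry[OF C(4)] by (simp add: algebra_simps flip: sum_subtractf)
  also have "\<dots> = (\<Sum>k<n. \<Sum>l<n. if l = j then if k = i
      then A $$ (i, i) * (P $$ (i, j) - Q $$ (i, j)) * B $$ (j, j) else 0 else 0)"
  proof (intro sum.cong refl)
    fix k l assume kl: "k \<in> {..<n}" "l \<in> {..<n}"
    \<comment> \<open>A term survives triangularity and agreement only if \<open>i \<le> k\<close>,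
      \<open>l \<le> j\<close> and \<open>k + m \<le> l\<close>; with \<open>j \<le> i + m\<close>
      this forces \<open>k = i\<close> and \<open>l = j\<close>.\<close>
    consider "k = i" "l = j" | "k < i" | "j < l" | "l < k + m"
      using ij by linarith
    then show "A $$ (i, k) * (P $$ (k, l) - Q $$ (k, l)) * B $$ (l, j) = (if l = j then if k = i
      then A $$ (i, i) * (P $$ (i, j) - Q $$ (i, j)) * B $$ (j, j) else 0 else 0)"
    proof cases
      case 2
      then show ?thesis using upper_triangularD[OF ut(1), of k i] C ij by auto
    next
      case 3
      then show ?thesis using upper_triangularD[OF ut(2), of j l] C kl by auto
    next
      case 4
      then show ?thesis using eq[of k l] kl by auto
    qed auto
  qed
  also have "\<dots> = A $$ (i, i) * (P $$ (i, j) - Q $$ (i, j)) * B $$ (j, j)"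
    using ij by simp
  finally show ?thesis .
qed

lemma mat_val_diag:
  assumes M: "\<And>x. M x \<in> carrier (UpmT n)" and i: "i < n"
  shows "mat_val n M w $$ (i, i) = prod_list (map (\<lambda>l. letter_val (UpmT n) M l $$ (i, i)) w)"
proof (induction w)
  case (Cons l w)
  have "letter_val (UpmT n) M l \<in> carrier (UpmT n)" "mat_val n M w \<in> carrier (UpmT n)"
    using letter_val_UpmT[of M n l] mat_val_UpmT[of M n w] M by blast+
  then show ?case
    using Cons upper_triangular_mult_entry[of "letter_val (UpmT n) M l" n "mat_val n M w" i i] i
    by (simp add: carrier_UpmT)
qed (use i in simp)

lemma malcev_identity:
  fixes N :: "nat \<Rightarrow> 'a::field mat"
  assumes N: "\<And>x. N x \<in> carrier (UpmT n)" and diag: "\<And>x i. i < n \<Longrightarrow> N x $$ (i, i) = d i"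
  shows "mat_val n N (map Var (malcev False n)) = mat_val n N (map Var (malcev True n))"
proof -
  define P where "P b m = mat_val n N (map Var (malcev b m))" for b m
  have PT: "P b m \<in> carrier (UpmT n)" for b m
    unfolding P_def by (rule mat_val_UpmT[OF N])
  have C: "P b m \<in> carrier_mat n n" "upper_triangular (P b m)"
    "N x \<in> carrier_mat n n" "upper_triangular (N x)" for b m x
    using PT[of b m] N[of x] by (auto simp: carrier_UpmT)
  have d3: "d i * d i * d i = d i" if "i < n" for i
  proof -
    have "d i = 0 \<or> d i = 1 \<or> d i = -1"
      using N[of 0] diag[of i 0] that by (auto simp: carrier_UpmT)
    then show ?thesis by (elim disjE) simp_all
  qed
  have Suc_eq: "P b (Suc m) = N (3*m+2) * (P b m * (N (3*m+3) * (P (\<not> b) m * N (3*m+4))))" for b m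
    unfolding P_def using mat_val_append[of N n] N right_mult_one_mat[OF C(3)] by simp
  have prod_diag: "(A * B) $$ (i, i) = A $$ (i, i) * B $$ (i, i)"
    if "A \<in> carrier_mat n n" "B \<in> carrier_mat n n" "upper_triangular A" "upper_triangular B" "i < n"
    for A B :: "'a mat" and i
    using upper_triangular_mult_entry[OF that(1-4), of i i] that by simp
  have ut_mult: "upper_triangular (A * B)"
    if "A \<in> carrier_mat n n" "B \<in> carrier_mat n n" "upper_triangular A" "upper_triangular B"
    for A B :: "'a mat"
    using upper_triangular_mult_entry[OF that] that by (intro upper_triangularI) auto
  have P_diag: "P b m $$ (i, i) = d i" if i: "i < n" for b m i
  proof (induction m arbitrary: b)
    case 0
    show ?case
      unfolding P_def mat_val_diag[of N n i, OF N i] using diag[OF i] by (cases b) simp_all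
  next
    case (Suc m)
    have "P b (Suc m) $$ (i, i) = d i * (d i * (d i * (d i * d i)))"
      unfolding P_def mat_val_diag[of N n i, OF N i] malcev.simps
      using Suc[unfolded P_def mat_val_diag[of N n i, OF N i]] diag[OF i] by (simp add: comp_def)
    also have "\<dots> = (d i * d i * d i) * d i * d i"
      by (simp only: mult.assoc)
    finally show ?case
      unfolding d3[OF i] .
  qed
  have level: "P False m $$ (i, j) = P True m $$ (i, j)" if "i < n" "j < n" "j < i + Suc m" for m i j
    using that
  proof (induction m arbitrary: i j)
    case 0
    then show ?case
      using P_diag[of i False 0] P_diag[of i True 0] upper_triangularD[OF C(2), of j i]
        carrier_matD(1)[OF C(1)] by (cases "i = j") auto
  next
    case (Suc m)
    define W Z W' where "W = N (3*m+2)" and "Z = N (3*m+3)" and "W' = N (3*m+4)"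
    define p q where "p = P False m" and "q = P True m"
    have CC: "W \<in> carrier_mat n n" "Z \<in> carrier_mat n n" "W' \<in> carrier_mat n n" "p \<in> carrier_mat n n" "q \<in> carrier_mat n n"
      "upper_triangular W" "upper_triangular Z" "upper_triangular W'" "upper_triangular p" "upper_triangular q"
      unfolding W_def Z_def W'_def p_def q_def using C by auto
    have dd: "W $$ (i, i) = d i" "Z $$ (i, i) = d i" "W' $$ (i, i) = d i" "p $$ (i, i) = d i" "q $$ (i, i) = d i"
      if "i < n" for i
      unfolding W_def Z_def W'_def p_def q_def using that diag P_diag by auto
    have eq: "p $$ (k, l) = q $$ (k, l)" if "k < n" "l < n" "l < k + Suc m" for k l
      unfolding p_def q_def using Suc.IH that by blast
    have ij: "i < n" "j < n" "j \<le> i + Suc m" using Suc.prems by auto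
    \<comment> \<open>\<open>W p Z q W'\<close> and \<open>W q Z p W'\<close> are both compared with
      \<open>W q Z q W'\<close>; \<open>B\<close> and \<open>A\<close> are the contexts of the
      exchanged factor.\<close>
    define B where "B = Z * (q * W')"
    define A where "A = W * (q * Z)"
    have B: "B \<in> carrier_mat n n" "upper_triangular B" "B $$ (j, j) = d j * (d j * d j)"
      unfolding B_def using CC ij dd[of j] by (auto intro!: ut_mult simp: prod_diag ut_mult simp del: index_mult_mat(1))
    have A: "A \<in> carrier_mat n n" "upper_triangular A" "A $$ (i, i) = d i * (d i * d i)"
      unfolding A_def using CC ij dd[of i] by (auto intro!: ut_mult simp: prod_diag ut_mult simp del: index_mult_mat(1))
    have 1: "(W * (p * B)) $$ (i, j) - (W * (q * B)) $$ (i, j) = W $$ (i, i) * (p $$ (i, j) - q $$ (i, j)) * B $$ (j, j)"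
      by (rule sandwich_entry[OF CC(1) B(1) CC(4,5,6) B(2) eq ij])
    have 2: "(A * (p * W')) $$ (i, j) - (A * (q * W')) $$ (i, j) = A $$ (i, i) * (p $$ (i, j) - q $$ (i, j)) * W' $$ (j, j)"
      by (rule sandwich_entry[OF A(1) CC(3,4,5) A(2) CC(8) eq ij])
    have assoc: "A * (x * W') = W * (q * (Z * (x * W')))" if "x \<in> carrier_mat n n" for x
      unfolding A_def using CC that by (simp add: assoc_mult_mat[of _ n n _ n _ n])
    have F: "P False (Suc m) = W * (p * B)" and T: "P True (Suc m) = A * (p * W')"
      using Suc_eq[of False m] Suc_eq[of True m] assoc[OF CC(4)]
      by (simp_all add: W_def Z_def W'_def p_def q_def B_def)
    have "W * (q * B) = A * (q * W')"
      unfolding B_def assoc[OF CC(5)] ..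
    \<comment> \<open>The outer letters serve this balance: as \<open>d i\<close> and
      \<open>d j\<close> equal their cubes, both exchanges multiply the difference by
      \<open>d i * d j\<close>. Without \<open>W\<close> and \<open>W'\<close> the factors would be
      squares of \<open>d j\<close> and of \<open>d i\<close>, which can differ.\<close>
    moreover have "W $$ (i, i) * (p $$ (i, j) - q $$ (i, j)) * B $$ (j, j) = A $$ (i, i) * (p $$ (i, j) - q $$ (i, j)) * W' $$ (j, j)"
      using d3[OF ij(1)] d3[OF ij(2)] unfolding A(3) B(3) dd(1)[OF ij(1)] dd(3)[OF ij(2)]
      by (simp only: mult.assoc)
    ultimately show ?case
      using 1 2 unfolding F T by (metis diff_add_cancel)
  qed
  have "P False n = P True n"
    by (rule eq_matI) (use level[of _ _ n] in \<open>simp_all add: carrier_matD[OF C(1)]\<close>)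
  then show ?thesis by (simp add: P_def)
qed

text \<open>The letters of \<open>alt_rows r (block_rows s x)\<close> are those of \<open>{..<s} \<times> {..<r}\<close>, each once, for every
  \<open>x\<close>.\<close>

definition block_rows :: "nat \<Rightarrow> nat \<Rightarrow> (nat \<times> nat) list" where
  "block_rows s x = map (\<lambda>j. (j, (j + x) mod s)) [0..<s]"

definition blocks :: "nat \<Rightarrow> nat list \<Rightarrow> (nat \<times> nat) list" where
  "blocks s w = concat (map (block_rows s) w)"

lemma filter_blocks:
  assumes "j < s"
  shows "filter (\<lambda>z. fst z = j) (blocks s w) = map (\<lambda>x. (j, (j + x) mod s)) w"
proof -
  have "filter (\<lambda>i. i = j) [0..<s] = [j]"
  proof -
    have "[0..<s] = [0..<j] @ [j] @ [Suc j..<s]"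
      using assms upt_add_eq_append[of 0 j "s - j"] by (simp add: upt_conv_Cons)
    then show ?thesis by (auto simp: filter_empty_conv)
  qed
  then have "filter (\<lambda>z. fst z = j) (block_rows s x) = [(j, (j + x) mod s)]" for x
    by (simp add: block_rows_def filter_map comp_def)
  then show ?thesis
    by (induction w) (auto simp: blocks_def)
qed

lemma inj_on_block: "inj_on (\<lambda>x. (j, (j + x) mod s)) {..<s :: nat}"
  unfolding inj_on_def
proof (intro ballI impI)
  fix x y assume *: "x \<in> {..<s}" "y \<in> {..<s}" "(j, (j + x) mod s) = (j, (j + y) mod s)"
  then have "(int j + int x) mod int s = (int j + int y) mod int s"
    by (metis Pair_inject of_nat_add zmod_int)
  then have "int x mod int s = int y mod int s"
    by (metis add_diff_cancel_left' mod_diff_left_eq)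
  with * show "x = y" by simp
qed

text \<open>For each \<open>j\<close> the pairs with first component \<open>j\<close> form a copy of
  \<open>w\<close> under an injective renaming. The share of an even factor in such a copy comes
  from an even factor of \<open>w\<close>, hence is empty.\<close>

lemma blocks_no_even_factor:
  assumes w: "no_even_factor w" "set w \<subseteq> {..<s}"
  shows "no_even_factor (blocks s w)"
  unfolding no_even_factor_def
proof (intro allI impI)
  fix a e b assume eq: "blocks s w = a @ e @ b" and ev: "\<forall>x. even (count_list e x)"
  have "filter (\<lambda>z. fst z = j) e = []" if j: "j < s" for j
  proof -
    let ?h = "\<lambda>x. (j, (j + x) mod s)"
    let ?f = "filter (\<lambda>z. fst z = j)"
    have "map ?h w = ?f a @ ?f e @ ?f b"
      using filter_blocks[OF j, of w] unfolding eq by simp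
    then obtain a' w2 where 1: "w = a' @ w2" "?f e @ ?f b = map ?h w2"
      by (auto simp: map_eq_append_conv)
    then obtain e' b' where 2: "w2 = e' @ b'" "?f e = map ?h e'"
      by (auto simp: map_eq_append_conv append_eq_map_conv)
    have w': "w = a' @ e' @ b'" "?f e = map ?h e'"
      using 1 2 by simp_all
    have "e' = []"
    proof (rule no_even_factorD[OF w(1) w'(1)])
      fix x
      show "even (count_list e' x)"
      proof (cases "x \<in> set e'")
        case True
        have "inj_on ?h (set e')"
          using inj_on_subset[OF inj_on_block] w(2) w'(1) by auto
        then have "count_list (map ?h e') (?h x) = count_list e' x"
          using True by (intro count_list_inj_map)
        then show ?thesis
          using even_count_filter[of e "?h x" "\<lambda>z. fst z = j"] ev w'(2) by metis
      qed simp
    qed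
    then show ?thesis using w'(2) by simp
  qed
  moreover have "fst z < s" if "z \<in> set e" for z
  proof -
    have "z \<in> set (blocks s w)" using that eq by simp
    then show ?thesis by (auto simp: blocks_def block_rows_def)
  qed
  ultimately have "z \<notin> set e" for z
    by (metis (mono_tags, lifting) filter_empty_conv)
  then show "e = []"
    by (cases e) auto
qed

lemma even_count_concat:
  assumes "\<And>x. even (count_list e x)"
  shows "even (count_list (concat (map \<phi> e)) z)"
proof -
  have "count_list (concat (map \<phi> e)) z = (\<Sum>x\<leftarrow>e. count_list (\<phi> x) z)"
    by (induction e) auto
  also have "\<dots> = (\<Sum>x\<in>set e. count_list e x * count_list (\<phi> x) z)"
    by (rule sum_list_map_eq_sum_count)
  finally show ?thesis
    using assms by (simp add: dvd_sum)
qed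

text \<open>An even factor of \<open>u\<close> decodes to an even factor of \<open>g\<close>, which
  is empty. Then all its variables are short, so the phases increase strictly along it and no letter
  repeats, against evenness.\<close>

lemma no_even_factor_desubstitution:
  fixes \<phi> :: "'v \<Rightarrow> (nat \<times> nat) list"
  assumes g: "no_even_factor g" and eq: "p @ concat (map \<phi> u) @ s = alt_rows r g"
    and ne: "\<forall>x\<in>set u. \<phi> x \<noteq> []" and r: "Suc (card (set u)) < r"
  shows "no_even_factor u"
  unfolding no_even_factor_def
proof (intro allI impI)
  fix a e b assume u: "u = a @ e @ b" and ev: "\<forall>x. even (count_list e x)"
  have eq': "(p @ concat (map \<phi> a)) @ concat (map \<phi> e) @ (concat (map \<phi> b) @ s) = alt_rows r g"
    using eq u by simp
  have "card (set e) \<le> card (set u)"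
    using u by (intro card_mono) auto
  then have r': "Suc (card (set e)) < r" using r by simp
  have ne': "\<forall>x\<in>set e. \<phi> x \<noteq> []" using ne u by simp
  obtain \<phi>' \<alpha> \<beta> p' s' where *: "p' @ concat (map \<phi>' e) @ s' = g"
      "successively (\<lambda>x y. \<beta> x = (\<alpha> y :: nat)) e"
      "\<forall>x\<in>set e. \<phi>' x = [] \<longrightarrow> \<alpha> x < \<beta> x"
    using desubstitution[OF eq' ne' r'] by (elim exE conjE)
  have "concat (map \<phi>' e) = []"
    by (rule no_even_factorD[OF g *(1)[symmetric]]) (rule even_count_concat, simp add: ev)
  then have "\<forall>x\<in>set e. \<alpha> x < \<beta> x"
    using *(3) by simp
  then have "successively (\<lambda>x y. \<alpha> x < \<alpha> y) e"
    using *(2) by (auto elim!: successively_mono)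
  then have "sorted_wrt (\<lambda>x y. \<alpha> x < \<alpha> y) e"
    by (subst (asm) successively_conv_sorted_wrt) (auto simp: transp_def)
  then have "distinct e"
    using strict_sorted_iff[of "map \<alpha> e"] by (simp add: sorted_wrt_map distinct_map)
  show "e = []"
  proof (cases e)
    case (Cons x e')
    then have "count_list e x = 1"
      using \<open>distinct e\<close> by simp
    then show ?thesis using ev by (metis odd_one)
  qed
qed

text \<open>Every block uses each letter once, so its diagonal is the product over all letters,
  whatever \<open>x\<close> is; the values of the blocks therefore fall under
  \<open>malcev_identity\<close>.\<close>

lemma blocks_identity:
  fixes enc :: "nat \<times> nat \<Rightarrow> nat"
  assumes s: "0 < s"
  shows "mat_identity TYPE('a::field) n
    (map (Var \<circ> enc) (alt_rows r (blocks s (malcev False n))))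
    (map (Var \<circ> enc) (alt_rows r (blocks s (malcev True n))))"
  unfolding mat_identity_def
proof (intro allI impI)
  fix M :: "nat \<Rightarrow> 'a mat" assume M: "\<forall>x. M x \<in> carrier (UpmT n)"
  define N where "N x = mat_val n M (map (Var \<circ> enc) (alt_rows r (block_rows s x)))" for x
  have N: "N x \<in> carrier (UpmT n)" for x
    unfolding N_def using mat_val_UpmT M by blast
  have "mat_val n M (map (Var \<circ> enc) (alt_rows r (blocks s w))) = mat_val n N (map Var w)" for w
  proof (induction w)
    case (Cons x w)
    have "map (Var \<circ> enc) (alt_rows r (blocks s (x # w))) =
        map (Var \<circ> enc) (alt_rows r (block_rows s x)) @ map (Var \<circ> enc) (alt_rows r (blocks s w))"
      by (simp add: blocks_def alt_rows_def)
    then have "mat_val n M (map (Var \<circ> enc) (alt_rows r (blocks s (x # w)))) =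
        N x * mat_val n M (map (Var \<circ> enc) (alt_rows r (blocks s w)))"
      unfolding N_def by (simp only:) (rule mat_val_append, use M in blast)
    then show ?case
      by (simp only: Cons list.map mat_val_simps letter_val.simps)
  qed (simp add: blocks_def alt_rows_def)
  moreover have "N x $$ (i, i) = (\<Prod>t<r. \<Prod>j<s. M (enc (j, t)) $$ (i, i))" if i: "i < n" for x i
  proof -
    define \<delta> where "\<delta> z = M (enc z) $$ (i, i)" for z
    have upt: "prod_list (map h [0..<m]) = (\<Prod>t<m. h t)" for h :: "nat \<Rightarrow> 'a" and m
      by (induction m) (auto simp: lessThan_Suc mult.commute)
    have row: "prod_list (map \<delta> (alt_row r (p, q))) = (\<Prod>t<r. \<delta> (if even t then p else q, t))" for p q
      by (simp add: alt_row_def comp_def upt)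
    have rows: "prod_list (map \<delta> (alt_rows r g)) = prod_list (map (\<lambda>z. prod_list (map \<delta> (alt_row r z))) g)" for g
      by (induction g) (simp_all add: alt_rows_def)
    have "N x $$ (i, i) = prod_list (map \<delta> (alt_rows r (block_rows s x)))"
      unfolding N_def using mat_val_diag[of M n i] M i by (simp add: comp_def \<delta>_def[abs_def])
    also have "\<dots> = prod_list (map (\<lambda>z. prod_list (map \<delta> (alt_row r z))) (block_rows s x))"
      by (rule rows)
    also have "\<dots> = (\<Prod>j<s. \<Prod>t<r. \<delta> (if even t then j else (j + x) mod s, t))"
      by (simp add: block_rows_def comp_def row upt)
    also have "\<dots> = (\<Prod>t<r. \<Prod>j<s. \<delta> (if even t then j else (j + x) mod s, t))"
      by (rule prod.swap)
    also have "\<dots> = (\<Prod>t<r. \<Prod>j<s. \<delta> (j, t))"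
    proof (rule prod.cong[OF refl])
      fix t
      have "(\<lambda>j. (j + x) mod s) = (\<lambda>j. (x + j) mod s)"
        by (simp only: add.commute)
      then have inj: "inj_on (\<lambda>j. (j + x) mod s) {..<s}"
        using inj_on_block[of x s] by (simp only: inj_on_def prod.inject simp_thms)
      then have "(\<lambda>j. (j + x) mod s) ` {..<s} = {..<s}"
        using s by (intro endo_inj_surj) auto
      then have "(\<Prod>j<s. \<delta> ((j + x) mod s, t)) = (\<Prod>j<s. \<delta> (j, t))"
        using prod.reindex[OF inj, of "\<lambda>j. \<delta> (j, t)"] by (simp add: comp_def)
      then show "(\<Prod>j<s. \<delta> (if even t then j else (j + x) mod s, t)) = (\<Prod>j<s. \<delta> (j, t))"
        by (cases "even t") simp_all
    qed
    finally show ?thesis by (simp add: \<delta>_def)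
  qed
  ultimately show "mat_val n M (map (Var \<circ> enc) (alt_rows r (blocks s (malcev False n)))) =
      mat_val n M (map (Var \<circ> enc) (alt_rows r (blocks s (malcev True n))))"
    using malcev_identity[of N n "\<lambda>i. \<Prod>t<r. \<Prod>j<s. M (enc (j, t)) $$ (i, i)", OF N] by simp
qed

lemma nonfinitely_based_UpmT:
  assumes char: "CHAR('a::field) = 0" and n: "2 \<le> n"
  shows "nonfinitely_based (UpmT n :: 'a mat invsg)"
proof (rule nonfinitely_basedI[OF involutory_semigroup_UpmT])
  fix k
  \<comment> \<open>All letters of the Malcev words are below \<open>s\<close>, so different letters
    have different shifts.\<close>
  define s where "s = 3*n+2"
  define f where "f b = alt_rows (k + 2) (blocks s (malcev b n))" for b
  define L where "L = {w. w \<noteq> [] \<and> (\<exists>p q. p @ w @ q = f False)}"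
  have letters: "set (malcev b n) \<subseteq> {..<s}" for b
    using malcev_letters by (auto simp: s_def)
  \<comment> \<open>Decoding the rows and then selecting first component \<open>0\<close> recovers
    the Malcev words up to an injective renaming.\<close>
  have "f True \<noteq> f False"
  proof
    assume "f True = f False"
    then have "read_rows 0 (f True) = read_rows 0 (f False)"
      by simp
    then have "blocks s (malcev True n) = blocks s (malcev False n)"
      unfolding f_def by (simp add: read_rows_alt_rows)
    then have "map (\<lambda>x. (0 :: nat, (0 + x) mod s)) (malcev True n) = map (\<lambda>x. (0, (0 + x) mod s)) (malcev False n)"
      using filter_blocks[of 0 s] by (metis s_def add_gr_0 zero_less_numeral)
    moreover have "inj_on (\<lambda>x. (0 :: nat, (0 + x) mod s)) (set (malcev True n) \<union> set (malcev False n))"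
      by (rule inj_on_subset[OF inj_on_block]) (use letters in blast)
    ultimately have "malcev True n = malcev False n"
      by (simp only: inj_on_map_eq_map)
    then show False using malcev_neq[of n] by simp
  qed
  moreover have ne: "f b \<noteq> []" for b
  proof -
    obtain x xs where "malcev b n = x # xs" by (cases n) auto
    then show ?thesis
      using alt_row_nonempty[of "k + 2"] by (auto simp: f_def blocks_def block_rows_def alt_rows_def s_def upt_conv_Cons)
  qed
  moreover have "factor_language L"
    unfolding factor_language_def L_def by clarsimp (metis append.assoc)
  moreover have "f False \<in> L"
    unfolding L_def using ne by (auto intro!: exI[of _ "[]"])
  moreover have "rigid (UpmT n :: 'a mat invsg) k L"
    unfolding rigid_def isoterm_def
  proof (intro allI impI)
    fix u :: "nat list" and \<phi> :: "nat \<Rightarrow> (nat \<times> nat) list" and v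
    assume u: "u \<noteq> []" "card (set u) \<le> k" "\<forall>x\<in>set u. \<phi> x \<noteq> []" "concat (map \<phi> u) \<in> L"
      and v: "v \<noteq> []" "holds_in (map Var u, v) (UpmT n :: 'a mat invsg)"
    obtain p q where pq: "p @ concat (map \<phi> u) @ q = alt_rows (k + 2) (blocks s (malcev False n))"
      using u(4) by (auto simp: L_def f_def)
    have "no_even_factor u"
      by (rule no_even_factor_desubstitution[OF
          blocks_no_even_factor[OF no_even_factor_malcev letters] pq]) (use u in auto)
    moreover have id: "mat_identity TYPE('a) n (map Var u) v"
      using holds_in_UpmT[of "map Var u" v n, where 'a = 'a] u(1) v by simp
    moreover obtain v' where "v = map Var v'"
      using mat_identity_unstarred[OF n id] by blast
    ultimately show "v = map Var u"
      using isoterm_char_0[OF char n] by metis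
  qed
  moreover have "(map (Var \<circ> to_nat) (f False), map (Var \<circ> to_nat) (f True)) \<in> identities_of (UpmT n :: 'a mat invsg)"
    using blocks_identity[of s n to_nat "k + 2", where 'a = 'a] ne
    by (simp add: identities_of_def identities_def free_invsg_def holds_in_UpmT f_def s_def)
  ultimately show "\<exists>(L :: (nat \<times> nat) list set) f f'. factor_language L \<and> rigid (UpmT n :: 'a mat invsg) k L \<and>
      f \<in> L \<and> f' \<noteq> f \<and> (map (Var \<circ> to_nat) f, map (Var \<circ> to_nat) f') \<in> identities_of (UpmT n :: 'a mat invsg)"
    by blast
qed

theorem proposition3p5:
  fixes n :: nat
  assumes "n \<ge> 2"
  shows "(CHAR('a::field) = 0 \<longrightarrow> nonfinitely_based (UpmT n :: 'a mat invsg)) \<and>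
         (odd CHAR('a) \<and> n \<ge> 4 \<longrightarrow> inherently_nonfinitely_based (UpmT n :: 'a mat invsg))"
  using nonfinitely_based_UpmT inherently_nonfinitely_based_UpmT assms by blast

end
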